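(* Let $[H,G]$ be a Boolean interval of finite groups of index $|G:H| < 32$. Then the graded coset poset $\hat{C}(H,G)$ is Cohen-Macaulay, and the nontrivial reduced Betti number of the order complex $\Delta(C(H,G))$ is nonzero; that is, if $[H,G]$ has rank $n+1$, then $\tilde{\beta}_n(\Delta(C(H,G))) \neq 0$.
   Context: An interval of finite groups $[H,G]$ is the lattice of all subgroups $K$ with $H \subseteq K \subseteq G$, where $G$ is a finite group and $H$ a subgroup. It is Boolean of rank $m$ if it is isomorphic to the lattice of subsets of an $m$-element set. The coset poset $C(H,G)$ is the set of all right cosets $Kg$ with $g \in G$ and $K \in [H,G]$, $K \neq G$, ordered by inclusion, and $\hat{C}(H,G) := C(H,G) \sqcup \{\emptyset, G\}$, ordered by inclusion. The order complex $\Delta(P)$ of a finite poset $P$ is the simplicial complex whose faces are the chains of $P$. $\tilde{\beta}_i(\Delta)$ denotes the dimension of the $i$th reduced homology (over $\mathbb{C}$) of $\Delta$. A finite poset is graded if it has a minimum and a maximum and all its maximal chains have the same length. A graded poset $Q$ is Cohen-Macaulay (over $\mathbb{C}$) if for every open interval $(x,y)$ in $Q$, $\tilde{\beta}_i(\Delta((x,y))) = 0$ for all $i < \dim \Delta((x,y))$. When $[H,G]$ has rank $n+1$, $\dim\Delta(C(H,G)) = n$, and if $\hat{C}(H,G)$ is Cohen-Macaulay, the only possibly nontrivial reduced Betti number is the one in degree $n$. *)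

theory Defs
  imports Complex_Main "HOL-Algebra.Coset" "HOL-Library.Poly_Mapping"
begin

section \<open>Finite posets and Boolean lattices\<close>

text \<open>
  A poset is given as a subset of a type of class \<open>order\<close>. For a family of sets the
  order \<open>\<le>\<close> is inclusion.
\<close>

definition order_isomorphic :: "'a::order set \<Rightarrow> 'b::order set \<Rightarrow> bool" where
  "order_isomorphic P Q \<longleftrightarrow>
     (\<exists>f. bij_betw f P Q \<and> (\<forall>x\<in>P. \<forall>y\<in>P. x \<le> y \<longleftrightarrow> f x \<le> f y))"

text \<open>Between lattices, order isomorphisms and lattice isomorphisms are the same maps.\<close>

definition boolean_of_rank :: "'a::order set \<Rightarrow> nat \<Rightarrow> bool" where
  "boolean_of_rank P m \<longleftrightarrow> order_isomorphic P (Pow {..<m})"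

definition graded_poset :: "'a::order set \<Rightarrow> bool" where
  "graded_poset P \<longleftrightarrow>
     finite P \<and> (\<exists>x\<in>P. \<forall>y\<in>P. x \<le> y) \<and> (\<exists>x\<in>P. \<forall>y\<in>P. y \<le> x) \<and>
     (\<forall>C D. pred_on.maxchain P (<) C \<longrightarrow> pred_on.maxchain P (<) D \<longrightarrow> card C = card D)"

definition order_complex :: "'a::order set \<Rightarrow> 'a set set" where
  "order_complex P = {C. finite C \<and> pred_on.chain P (<) C}"


section \<open>Reduced simplicial homology over the complex numbers\<close>

text \<open>
  The chain complex below is meant for simplicial complexes all of whose faces are finite
  chains in the order of the vertex type, in particular for order complexes. The vertex
  order then orients every face: for \<open>v\<^sub>0 < \<dots> < v\<^sub>k\<close>, the boundary of
  \<open>{v\<^sub>0, \<dots>, v\<^sub>k}\<close> is the sum of the \<open>(-1)^j {v\<^sub>0, \<dots>, v\<^sub>k} - {v\<^sub>j}\<close>.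
  The empty face spans the degree \<open>-1\<close> and the boundary of a vertex is the empty face,
  so that the homology is the reduced one.
\<close>

type_synonym 'a cchain = "'a set \<Rightarrow>\<^sub>0 complex"

definition scale_cchain :: "complex \<Rightarrow> 'a cchain \<Rightarrow> 'a cchain" where
  "scale_cchain a c = Poly_Mapping.map (\<lambda>z. a * z) c"

lemma lookup_scale_cchain [simp]:
  "Poly_Mapping.lookup (scale_cchain a c) s = a * Poly_Mapping.lookup c s"
  unfolding scale_cchain_def by transfer (simp add: when_def)

interpretation cchain: vector_space scale_cchain
  by unfold_locales (auto intro!: poly_mapping_eqI simp: lookup_add algebra_simps)

definition simplex_boundary :: "'a::order set \<Rightarrow> 'a cchain" where
  "simplex_boundary s =
     (\<Sum>v\<in>s. Poly_Mapping.single (s - {v}) ((-1) ^ card {w\<in>s. w < v}))"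

definition boundary :: "'a::order cchain \<Rightarrow> 'a cchain" where
  "boundary c =
     (\<Sum>s\<in>Poly_Mapping.keys c. scale_cchain (Poly_Mapping.lookup c s) (simplex_boundary s))"

definition faces :: "'a set set \<Rightarrow> int \<Rightarrow> 'a set set" where
  "faces \<Delta> i = {s\<in>\<Delta>. finite s \<and> int (card s) = i + 1}"

definition chain_space :: "'a set set \<Rightarrow> int \<Rightarrow> 'a cchain set" where
  "chain_space \<Delta> i = {c. Poly_Mapping.keys c \<subseteq> faces \<Delta> i}"

definition cycles :: "'a::order set set \<Rightarrow> int \<Rightarrow> 'a cchain set" where
  "cycles \<Delta> i = {c \<in> chain_space \<Delta> i. boundary c = 0}"

definition boundaries :: "'a::order set set \<Rightarrow> int \<Rightarrow> 'a cchain set" where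
  "boundaries \<Delta> i = boundary ` chain_space \<Delta> (i + 1)"

text \<open>
  For a finite complex this is the dimension of the quotient of the cycles by the
  boundaries; the subtraction is not truncated, see \<open>boundaries_subset_cycles\<close> below.
\<close>

definition reduced_betti :: "'a::order set set \<Rightarrow> int \<Rightarrow> nat" where
  "reduced_betti \<Delta> i = cchain.dim (cycles \<Delta> i) - cchain.dim (boundaries \<Delta> i)"

lemma boundary_sum_superset:
  assumes "finite A" "Poly_Mapping.keys c \<subseteq> A"
  shows "boundary c =
    (\<Sum>s\<in>A. scale_cchain (Poly_Mapping.lookup c s) (simplex_boundary s))"
  unfolding boundary_def
  using assms by (intro sum.mono_neutral_left) (auto simp: in_keys_iff)

lemma boundary_add: "boundary (c + d) = boundary c + boundary d"
proof -
  let ?A = "Poly_Mapping.keys c \<union> Poly_Mapping.keys d"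
  have "Poly_Mapping.keys (c + d) \<subseteq> ?A"
    by (rule Poly_Mapping.keys_add)
  then show ?thesis
    by (simp add: boundary_sum_superset [of ?A] lookup_add cchain.scale_left_distrib sum.distrib)
qed

lemma boundary_scale: "boundary (scale_cchain a c) = scale_cchain a (boundary c)"
proof -
  have "Poly_Mapping.keys (scale_cchain a c) \<subseteq> Poly_Mapping.keys c"
    by (auto simp: in_keys_iff)
  then show ?thesis
    by (simp add: boundary_sum_superset [of "Poly_Mapping.keys c"] cchain.scale_sum_right)
qed

lemma boundary_zero [simp]: "boundary 0 = 0"
  by (simp add: boundary_def)

lemma boundary_sum: "boundary (\<Sum>x\<in>A. f x) = (\<Sum>x\<in>A. boundary (f x))"
  by (induction A rule: infinite_finite_induct) (auto simp: boundary_add)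

lemma boundary_single: "boundary (Poly_Mapping.single s a) = scale_cchain a (simplex_boundary s)"
  by (cases "a = 0") (simp_all add: boundary_def)

lemma scale_single: "scale_cchain a (Poly_Mapping.single s b) = Poly_Mapping.single s (a * b)"
  by (intro poly_mapping_eqI) (simp add: lookup_single when_def)

lemma boundary_simplex_boundary:
  assumes fin: "finite s" and chain: "\<And>v w. v \<in> s \<Longrightarrow> w \<in> s \<Longrightarrow> v < w \<or> v = w \<or> w < v"
  shows "boundary (simplex_boundary s) = 0"
proof -
  define p where "p v = card {w\<in>s. w < v}" for v
  define T where
    "T v w = Poly_Mapping.single (s - {v, w}) ((-1::complex) ^ (p v + p w))" for v w
  have T_sym: "T v w = T w v" for v w
    by (simp add: T_def add.commute insert_commute)
  have pos: "(-1::complex) ^ card {u\<in>s - {v}. u < w} = (if v < w then - 1 else 1) * (-1) ^ p w"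
    if "v \<in> s" for v w
  proof (cases "v < w")
    case True
    then have "{u\<in>s. u < w} = insert v {u\<in>s - {v}. u < w}"
      using that by auto
    then have "p w = Suc (card {u\<in>s - {v}. u < w})"
      using fin by (simp add: p_def)
    then show ?thesis using True by simp
  next
    case False
    then have "{u\<in>s - {v}. u < w} = {u\<in>s. u < w}" by auto
    then show ?thesis using False by (simp add: p_def)
  qed
  have "boundary (simplex_boundary s)
      = (\<Sum>v\<in>s. \<Sum>w\<in>s - {v}. if v < w then - T v w else T v w)"
    unfolding simplex_boundary_def boundary_sum boundary_single cchain.scale_sum_right scale_single
  proof (intro sum.cong refl)
    fix v w assume v: "v \<in> s" and "w \<in> s - {v}"
    have "s - {v} - {w} = s - {v, w}" by auto
    then show "Poly_Mapping.single (s - {v} - {w})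
        ((-1) ^ card {w\<in>s. w < v} * (-1::complex) ^ card {wa\<in>s - {v}. wa < w})
      = (if v < w then - T v w else T v w)"
      unfolding pos [OF v] by (simp add: T_def p_def power_add single_uminus)
  qed
  also have "\<dots> = (\<Sum>v\<in>s. \<Sum>w\<in>s. (if w < v then T v w else 0) - (if v < w then T v w else 0))"
  proof (rule sum.cong [OF refl])
    fix v assume "v \<in> s"
    show "(\<Sum>w\<in>s - {v}. if v < w then - T v w else T v w)
        = (\<Sum>w\<in>s. (if w < v then T v w else 0) - (if v < w then T v w else 0))"
      using fin \<open>v \<in> s\<close> chain by (intro sum.mono_neutral_cong_left) (auto dest: less_asym)
  qed
  also have "\<dots> = (\<Sum>v\<in>s. \<Sum>w\<in>s. if w < v then T v w else 0)
      - (\<Sum>v\<in>s. \<Sum>w\<in>s. if v < w then T v w else 0)"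
    by (simp add: sum_subtractf)
  also have "(\<Sum>v\<in>s. \<Sum>w\<in>s. if v < w then T v w else 0)
      = (\<Sum>v\<in>s. \<Sum>w\<in>s. if w < v then T v w else 0)"
    by (subst sum.swap) (intro sum.cong refl, metis T_sym)
  finally show ?thesis by simp
qed

lemma keys_simplex_boundary:
  "Poly_Mapping.keys (simplex_boundary s) \<subseteq> {s - {v} | v. v \<in> s}"
  unfolding simplex_boundary_def by (rule order_trans [OF keys_sum]) (auto split: if_splits)

lemma boundaries_subset_cycles:
  assumes chain: "\<And>s v w. s \<in> \<Delta> \<Longrightarrow> v \<in> s \<Longrightarrow> w \<in> s \<Longrightarrow> v < w \<or> v = w \<or> w < v"
    and down: "\<And>s t. s \<in> \<Delta> \<Longrightarrow> t \<subseteq> s \<Longrightarrow> t \<in> \<Delta>"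
  shows "boundaries \<Delta> i \<subseteq> cycles \<Delta> i"
proof
  fix b assume "b \<in> boundaries \<Delta> i"
  then obtain c where c: "Poly_Mapping.keys c \<subseteq> faces \<Delta> (i + 1)" and b: "b = boundary c"
    by (auto simp: boundaries_def chain_space_def)
  have "boundary b = 0"
    unfolding b boundary_def [of c] boundary_sum boundary_scale
  proof (rule sum.neutral, intro ballI)
    fix s assume "s \<in> Poly_Mapping.keys c"
    then have "s \<in> \<Delta>" "finite s" using c by (auto simp: faces_def)
    then show "scale_cchain (Poly_Mapping.lookup c s) (boundary (simplex_boundary s)) = 0"
      using boundary_simplex_boundary [of s] chain by simp
  qed
  moreover have "Poly_Mapping.keys b \<subseteq> faces \<Delta> i"
  proof
    fix t assume "t \<in> Poly_Mapping.keys b"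
    then obtain s where s: "s \<in> Poly_Mapping.keys c"
      and "t \<in> Poly_Mapping.keys (scale_cchain (Poly_Mapping.lookup c s) (simplex_boundary s))"
      unfolding b boundary_def by (metis (no_types, lifting) UN_E keys_sum subsetD)
    then have "t \<in> Poly_Mapping.keys (simplex_boundary s)"
      by (auto simp: in_keys_iff)
    then obtain v where v: "v \<in> s" and t: "t = s - {v}"
      using keys_simplex_boundary by blast
    from s c have "s \<in> \<Delta>" "finite s" "int (card s) = i + 2"
      by (auto simp: faces_def)
    then show "t \<in> faces \<Delta> i"
      using card_Suc_Diff1 [of s v] v t down [of s t] by (auto simp: faces_def)
  qed
  ultimately show "b \<in> cycles \<Delta> i"
    by (simp add: cycles_def chain_space_def)
qed


section \<open>Cohen-Macaulay posets\<close>

text \<open>The complex with the empty face only has dimension \<open>-1\<close>.\<close>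

definition complex_dim :: "'a set set \<Rightarrow> int" where
  "complex_dim \<Delta> = Max ((\<lambda>s. int (card s) - 1) ` \<Delta>)"

definition cohen_macaulay :: "'a::order set \<Rightarrow> bool" where
  "cohen_macaulay Q \<longleftrightarrow> graded_poset Q \<and>
     (\<forall>x\<in>Q. \<forall>y\<in>Q. x < y \<longrightarrow>
       (\<forall>i < complex_dim (order_complex (Q \<inter> {x<..<y})).
          reduced_betti (order_complex (Q \<inter> {x<..<y})) i = 0))"


section \<open>Intervals of groups and coset posets\<close>

definition group_interval :: "('a, 'b) monoid_scheme \<Rightarrow> 'a set \<Rightarrow> 'a set set" where
  "group_interval G H = {K. subgroup K G \<and> H \<subseteq> K}"

definition coset_poset :: "('a, 'b) monoid_scheme \<Rightarrow> 'a set \<Rightarrow> 'a set set" where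
  "coset_poset G H =
     {K #>\<^bsub>G\<^esub> g | K g. K \<in> group_interval G H \<and> K \<noteq> carrier G \<and> g \<in> carrier G}"

text \<open>The union is disjoint: cosets of proper subgroups are neither empty nor \<open>carrier G\<close>.\<close>

definition coset_poset_hat :: "('a, 'b) monoid_scheme \<Rightarrow> 'a set \<Rightarrow> 'a set set" where
  "coset_poset_hat G H = coset_poset G H \<union> {{}, carrier G}"

end

theory Submission
  imports Defs
begin

text \<open>
  The only topological tool is the insertion of one element into a poset: by the cone construction,
  inserting \<open>q\<close> glues a cone along the order complex of the link of \<open>q\<close>. So acyclicity below degree
  \<open>n\<close> survives if the link is acyclic below \<open>n - 1\<close>, and a nonzero \<open>(n - 1)\<close>-cycle in the link yields
  a nonzero \<open>n\<close>-cycle.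

  Let \<open>A\<close> be an atom of the interval and \<open>M\<close> its complement, a coatom. If \<open>G = A M\<close>, the cosets lying
  in \<open>M\<close> together with the cosets of the subgroups above \<open>A\<close> form an acyclic poset. The cosets inside
  another coset \<open>M x\<close> can then be inserted along links that are cones, except for \<open>M x\<close> itself, whose
  link is the coset poset of \<open>[H, M]\<close>; this is an induction on the rank.

  Such an atom exists whenever the rank is at least 3 and the index is less than 32. If \<open>|A : H| = 2\<close>,
  then \<open>A\<close> acts on the interval by conjugation, hence fixes \<open>M\<close>, and \<open>A M\<close> is a subgroup. If every atom
  has index at least 3 over \<open>H\<close>, then \<open>|M : H| \<ge> 9\<close>, so \<open>|G : M| \<le> 3 \<le> |A : H|\<close>. Rank 1 is
  trivial, and in rank 2 the order complex is a connected graph without vertices of degree 1.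
\<close>

section \<open>Cones and links\<close>

text \<open>The sign moves the apex \<open>q\<close> from the front of the oriented simplex to its
  place in the vertex order. The formula is the usual cone on chains whose simplices avoid
  \<open>q\<close>.\<close>

definition cone :: "'a::order \<Rightarrow> 'a cchain \<Rightarrow> 'a cchain" where
  "cone q c = (\<Sum>s\<in>Poly_Mapping.keys c. Poly_Mapping.single (insert q s)
     ((-1) ^ card {w\<in>s. w < q} * Poly_Mapping.lookup c s))"

text \<open>Its order complex is the link of the vertex \<open>q\<close> in the order complex of
  \<open>insert q R\<close>.\<close>

definition link :: "'a::order set \<Rightarrow> 'a \<Rightarrow> 'a set" where
  "link R q = {r\<in>R. r < q \<or> q < r}"

section \<open>Linearity and injectivity of the cone operator\<close>

lemma cone_sum_superset:
  assumes "finite A" "Poly_Mapping.keys c \<subseteq> A"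
  shows "cone q c = (\<Sum>s\<in>A. Poly_Mapping.single (insert q s)
     ((-1) ^ card {w\<in>s. w < q} * Poly_Mapping.lookup c s))"
  unfolding cone_def
  using assms by (intro sum.mono_neutral_left) (auto simp: in_keys_iff)

lemma cone_zero [simp]: "cone q 0 = 0"
  by (simp add: cone_def)

lemma cone_add: "cone q (c + d) = cone q c + cone q d"
proof -
  let ?A = "Poly_Mapping.keys c \<union> Poly_Mapping.keys d"
  have "Poly_Mapping.keys (c + d) \<subseteq> ?A"
    by (rule Poly_Mapping.keys_add)
  then show ?thesis
    by (simp add: cone_sum_superset [of ?A] lookup_add single_add sum.distrib algebra_simps)
qed

lemma cone_sum: "cone q (\<Sum>x\<in>A. f x) = (\<Sum>x\<in>A. cone q (f x))"
  by (induction A rule: infinite_finite_induct) (auto simp: cone_add)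

lemma cone_single:
  "cone q (Poly_Mapping.single s a) = Poly_Mapping.single (insert q s) ((-1) ^ card {w\<in>s. w < q} * a)"
  by (cases "a = 0") (simp_all add: cone_def)

lemma cone_diff: "cone q (c - d) = cone q c - cone q d"
  by (metis add_diff_cancel cone_add diff_add_cancel)

lemma boundary_diff: "boundary (c - d) = boundary c - boundary d"
  by (metis add_diff_cancel boundary_add diff_add_cancel)

lemma poly_mapping_sum_single:
  "c = (\<Sum>s\<in>Poly_Mapping.keys c. Poly_Mapping.single s (Poly_Mapping.lookup c s))"
proof (rule poly_mapping_eqI)
  fix k
  show "Poly_Mapping.lookup c k = Poly_Mapping.lookup
    (\<Sum>s\<in>Poly_Mapping.keys c. Poly_Mapping.single s (Poly_Mapping.lookup c s)) k"
    by (cases "k \<in> Poly_Mapping.keys c")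
      (auto simp: lookup_sum lookup_single when_def in_keys_iff)
qed

lemma lookup_cone_insert:
  assumes "\<And>s. s \<in> Poly_Mapping.keys c \<Longrightarrow> q \<notin> s" and "q \<notin> s"
  shows "Poly_Mapping.lookup (cone q c) (insert q s)
    = (-1) ^ card {w\<in>s. w < q} * Poly_Mapping.lookup c s"
proof -
  have "Poly_Mapping.lookup (cone q c) (insert q s)
      = (\<Sum>t\<in>Poly_Mapping.keys c. if t = s then (-1) ^ card {w\<in>s. w < q} * Poly_Mapping.lookup c s else 0)"
    unfolding cone_def lookup_sum
    by (intro sum.cong refl) (use assms in \<open>auto simp: lookup_single when_def insert_ident\<close>)
  then show ?thesis
    by (auto simp: in_keys_iff)
qed

lemma keys_cone: "Poly_Mapping.keys (cone q c) \<subseteq> insert q ` Poly_Mapping.keys c"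
  unfolding cone_def by (rule order_trans [OF keys_sum]) (auto split: if_splits)

text \<open>All simplices on the right contain \<open>q\<close> and none on the left does, so both
  sides vanish, and the cone operator is injective on chains avoiding \<open>q\<close>. This splits
  an identity of chains into a part without \<open>q\<close> and a part with
  \<open>q\<close>.\<close>

lemma cone_direct_sum:
  assumes x: "\<And>s. s \<in> Poly_Mapping.keys x \<Longrightarrow> q \<notin> s"
    and y: "\<And>s. s \<in> Poly_Mapping.keys y \<Longrightarrow> q \<notin> s"
    and eq: "x = cone q y"
  shows "x = 0" "y = 0"
proof -
  have "Poly_Mapping.keys x = {}"
    using x keys_cone [of q y] unfolding eq by blast
  then show "x = 0" by simp
  show "y = 0"
  proof (rule poly_mapping_eqI)
    fix s
    show "Poly_Mapping.lookup y s = Poly_Mapping.lookup 0 s"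
    proof (cases "q \<in> s")
      case True
      then show ?thesis using y by (auto simp: in_keys_iff)
    next
      case False
      then show ?thesis
        using lookup_cone_insert [of y q s] y \<open>x = 0\<close> eq by simp
    qed
  qed
qed

text \<open>The cone operator is a contracting homotopy.\<close>

lemma boundary_cone:
  assumes w: "\<And>s. s \<in> Poly_Mapping.keys w \<Longrightarrow> finite s \<and> (\<forall>v\<in>s. v < q \<or> q < v)"
  shows "boundary (cone q w) = w - cone q (boundary w)"
proof -
  have single: "boundary (cone q (Poly_Mapping.single s a))
      = Poly_Mapping.single s a - cone q (boundary (Poly_Mapping.single s a))"
    if s: "finite s" "\<forall>v\<in>s. v < q \<or> q < v" for s a
  proof -
    define e where "e = (-1::complex) ^ card {w\<in>s. w < q}"
    have "q \<notin> s" using s by auto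
    \<comment> \<open>Deleting \<open>v\<close> and inserting \<open>q\<close> anticommute: if
      \<open>v < q\<close>, the deletion lowers the position of \<open>q\<close> by one; if
      \<open>q < v\<close>, the insertion raises that of \<open>v\<close> by one.\<close>
    have sgn: "(-1::complex) ^ card {w\<in>insert q s. w < v} * e
        = - ((-1) ^ card {w\<in>s - {v}. w < q} * (-1) ^ card {w\<in>s. w < v})" if "v \<in> s" for v
    proof (cases "v < q")
      case True
      then have "{w\<in>s. w < q} = insert v {w\<in>s - {v}. w < q}"
        using that by auto
      then have "card {w\<in>s. w < q} = Suc (card {w\<in>s - {v}. w < q})"
        using s by simp
      moreover have "{w\<in>insert q s. w < v} = {w\<in>s. w < v}"
        using True by auto
      ultimately show ?thesis by (simp add: e_def)
    next
      case False
      then have "q < v" using s that by auto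
      then have "{w\<in>insert q s. w < v} = insert q {w\<in>s. w < v}" by auto
      then have "card {w\<in>insert q s. w < v} = Suc (card {w\<in>s. w < v})"
        using s \<open>q \<notin> s\<close> by simp
      moreover have "{w\<in>s - {v}. w < q} = {w\<in>s. w < q}"
        using False by auto
      ultimately show ?thesis by (simp add: e_def)
    qed
    have ee: "e * e = 1"
      by (simp add: e_def flip: power_add mult_2)
    have "boundary (cone q (Poly_Mapping.single s a))
        = (\<Sum>v\<in>insert q s. Poly_Mapping.single (insert q s - {v})
            (e * a * (-1) ^ card {w\<in>insert q s. w < v}))"
      by (simp add: cone_single boundary_single simplex_boundary_def cchain.scale_sum_right
          scale_single e_def)
    also have "\<dots> = Poly_Mapping.single s a + (\<Sum>v\<in>s. Poly_Mapping.single (insert q s - {v})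
            (e * a * (-1) ^ card {w\<in>insert q s. w < v}))"
    proof -
      have "{w \<in> insert q s. w < q} = {w \<in> s. w < q}" by auto
      then have "(-1) ^ card {w\<in>insert q s. w < q} = e" by (simp only: e_def)
      moreover have "e * a * e = a"
        using arg_cong [OF ee, of "\<lambda>x. x * a"] by (simp add: mult_ac)
      ultimately have 1: "e * a * (-1) ^ card {w\<in>insert q s. w < q} = a" by (simp only:)
      have 2: "insert q s - {q} = s" using \<open>q \<notin> s\<close> by auto
      show ?thesis
        by (simp only: sum.insert [OF s(1) \<open>q \<notin> s\<close>] 1 2)
    qed
    also have "(\<Sum>v\<in>s. Poly_Mapping.single (insert q s - {v})
            (e * a * (-1) ^ card {w\<in>insert q s. w < v}))
        = - cone q (boundary (Poly_Mapping.single s a))"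
      unfolding boundary_single simplex_boundary_def cchain.scale_sum_right cone_sum scale_single
        cone_single sum_negf[symmetric]
    proof (rule sum.cong [OF refl])
      fix v assume v: "v \<in> s"
      have "insert q s - {v} = insert q (s - {v})" using v \<open>q \<notin> s\<close> by auto
      moreover have "e * a * (-1) ^ card {w\<in>insert q s. w < v}
          = - ((-1) ^ card {w\<in>s - {v}. w < q} * (a * (-1) ^ card {w\<in>s. w < v}))"
        using arg_cong [OF sgn [OF v], of "\<lambda>x. a * x"] by (simp only: mult_ac mult_minus_right)
      ultimately show "Poly_Mapping.single (insert q s - {v}) (e * a * (-1) ^ card {w\<in>insert q s. w < v})
        = - Poly_Mapping.single (insert q (s - {v}))
            ((-1) ^ card {w\<in>s - {v}. w < q} * (a * (-1) ^ card {w\<in>s. w < v}))"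
        by (simp only: single_uminus)
    qed
    finally show ?thesis by simp
  qed
  have "boundary (cone q w) = (\<Sum>s\<in>Poly_Mapping.keys w.
      boundary (cone q (Poly_Mapping.single s (Poly_Mapping.lookup w s))))"
    by (subst poly_mapping_sum_single [of w]) (simp add: cone_sum boundary_sum)
  also have "\<dots> = (\<Sum>s\<in>Poly_Mapping.keys w. Poly_Mapping.single s (Poly_Mapping.lookup w s)
      - cone q (boundary (Poly_Mapping.single s (Poly_Mapping.lookup w s))))"
    by (intro sum.cong refl single) (use w in auto)
  also have "\<dots> = w - cone q (boundary w)"
    by (simp add: sum_subtractf poly_mapping_sum_single [symmetric] flip: cone_sum boundary_sum)
  finally show ?thesis .
qed


section \<open>Acyclicity of order complexes\<close>

lemma faces_order_complex_iff:
  "s \<in> faces (order_complex R) i \<longleftrightarrow> finite s \<and> s \<subseteq> R \<and>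
    (\<forall>x\<in>s. \<forall>y\<in>s. x < y \<or> x = y \<or> y < x) \<and> int (card s) = i + 1"
  unfolding faces_def order_complex_def pred_on.chain_def by auto

lemma chain_space_0 [simp]: "0 \<in> chain_space \<Delta> i"
  by (simp add: chain_space_def)

lemma chain_space_add: "a \<in> chain_space \<Delta> i \<Longrightarrow> b \<in> chain_space \<Delta> i \<Longrightarrow> a + b \<in> chain_space \<Delta> i"
  unfolding chain_space_def using Poly_Mapping.keys_add[of a b] by auto

lemma chain_space_diff: "a \<in> chain_space \<Delta> i \<Longrightarrow> b \<in> chain_space \<Delta> i \<Longrightarrow> a - b \<in> chain_space \<Delta> i"
  unfolding chain_space_def using Poly_Mapping.keys_diff[of a b] by auto

lemma chain_space_sum:
  "(\<And>x. x \<in> A \<Longrightarrow> f x \<in> chain_space \<Delta> i) \<Longrightarrow> (\<Sum>x\<in>A. f x) \<in> chain_space \<Delta> i"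
  by (induction A rule: infinite_finite_induct) (auto intro: chain_space_add)

lemma chain_space_single:
  "s \<in> faces \<Delta> i \<Longrightarrow> Poly_Mapping.single s a \<in> chain_space \<Delta> i"
  by (simp add: chain_space_def)

lemma chain_space_mono:
  "R \<subseteq> S \<Longrightarrow> a \<in> chain_space (order_complex R) i \<Longrightarrow> a \<in> chain_space (order_complex S) i"
proof -
  assume "R \<subseteq> S"
  then have "faces (order_complex R) i \<subseteq> faces (order_complex S) i"
    using subset_trans [of _ R S] by (simp add: faces_order_complex_iff subset_iff)
  then show "a \<in> chain_space (order_complex R) i \<Longrightarrow> a \<in> chain_space (order_complex S) i"
    by (auto simp: chain_space_def)
qed

lemma boundary_chain_space:
  assumes "c \<in> chain_space (order_complex R) i"
  shows "boundary c \<in> chain_space (order_complex R) (i - 1)"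
  unfolding boundary_def simplex_boundary_def cchain.scale_sum_right scale_single
proof (intro chain_space_sum chain_space_single)
  fix s v assume s: "s \<in> Poly_Mapping.keys c" and v: "v \<in> s"
  then have "s \<in> faces (order_complex R) i"
    using assms by (auto simp: chain_space_def)
  then show "s - {v} \<in> faces (order_complex R) (i - 1)"
    using v card_Suc_Diff1 [of s v] by (auto simp: faces_order_complex_iff)
qed

lemma cone_chain_space:
  assumes "c \<in> chain_space (order_complex (link R q)) i"
  shows "cone q c \<in> chain_space (order_complex (insert q R)) (i + 1)"
  unfolding cone_def
proof (intro chain_space_sum chain_space_single)
  fix s assume "s \<in> Poly_Mapping.keys c"
  then have "s \<in> faces (order_complex (link R q)) i"
    using assms by (auto simp: chain_space_def)
  moreover from this have "q \<notin> s" by (auto simp: faces_order_complex_iff link_def)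
  ultimately show "insert q s \<in> faces (order_complex (insert q R)) (i + 1)"
    by (auto simp: faces_order_complex_iff link_def)
qed

lemma chain_space_not_mem:
  "c \<in> chain_space (order_complex R) i \<Longrightarrow> q \<notin> R \<Longrightarrow> s \<in> Poly_Mapping.keys c \<Longrightarrow> q \<notin> s"
  by (metis chain_space_def faces_order_complex_iff mem_Collect_eq subsetD)

lemma link_subset: "link R q \<subseteq> R"
  by (auto simp: link_def)

lemma not_mem_link: "q \<notin> link R q"
  by (auto simp: link_def)

lemma boundary_cone_link:
  assumes "w \<in> chain_space (order_complex (link R q)) i"
  shows "boundary (cone q w) = w - cone q (boundary w)"
proof (rule boundary_cone)
  fix s assume "s \<in> Poly_Mapping.keys w"
  then have "s \<in> faces (order_complex (link R q)) i"
    using assms by (auto simp: chain_space_def)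
  then show "finite s \<and> (\<forall>v\<in>s. v < q \<or> q < v)"
    by (auto simp: faces_order_complex_iff link_def)
qed

text \<open>The simplices of \<open>z\<close> are sorted by whether they contain \<open>q\<close>;
  \<open>w\<close> is what remains of the second kind once \<open>q\<close> is removed with its
  sign.\<close>

lemma cone_decomposition:
  assumes z: "z \<in> chain_space (order_complex (insert q R)) i"
  obtains a w where "z = a + cone q w" "a \<in> chain_space (order_complex R) i"
    "w \<in> chain_space (order_complex (link R q)) (i - 1)"
proof
  let ?K = "Poly_Mapping.keys z" and ?l = "Poly_Mapping.lookup z"
  define a where "a = (\<Sum>s\<in>{s\<in>?K. q \<notin> s}. Poly_Mapping.single s (?l s))"
  define w where "w = (\<Sum>s\<in>{s\<in>?K. q \<in> s}. Poly_Mapping.single (s - {q})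
    ((-1) ^ card {w\<in>s - {q}. w < q} * ?l s))"
  have K: "s \<in> faces (order_complex (insert q R)) i" if "s \<in> ?K" for s
    using that z by (auto simp: chain_space_def)
  show "a \<in> chain_space (order_complex R) i"
    unfolding a_def
    by (intro chain_space_sum chain_space_single) (use K in \<open>auto simp: faces_order_complex_iff\<close>)
  show "w \<in> chain_space (order_complex (link R q)) (i - 1)"
    unfolding w_def
  proof (intro chain_space_sum chain_space_single)
    fix s assume s: "s \<in> {s\<in>?K. q \<in> s}"
    then have "s \<in> faces (order_complex (insert q R)) i" using K by auto
    then show "s - {q} \<in> faces (order_complex (link R q)) (i - 1)"
      using s card_Suc_Diff1 [of s q]
      by (force simp: faces_order_complex_iff link_def)
  qed
  have "cone q w = (\<Sum>s\<in>{s\<in>?K. q \<in> s}. Poly_Mapping.single s (?l s))"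
    unfolding w_def cone_sum cone_single
    by (intro sum.cong refl) (auto simp: insert_absorb simp flip: mult.assoc power_add mult_2)
  then have "a + cone q w = (\<Sum>s\<in>{s\<in>?K. q \<notin> s} \<union> {s\<in>?K. q \<in> s}. Poly_Mapping.single s (?l s))"
    unfolding a_def by (subst sum.union_disjoint) auto
  also have "{s\<in>?K. q \<notin> s} \<union> {s\<in>?K. q \<in> s} = ?K" by auto
  finally show "z = a + cone q w"
    using poly_mapping_sum_single [of z] by simp
qed

text \<open>The degree ranges over the integers and includes -1 as soon as \<open>n\<close> is
  nonnegative: \<open>acyclic_below 0 R\<close> means that \<open>R\<close> is nonempty,
  \<open>acyclic_below 1 R\<close> that it is connected as well.\<close>

definition acyclic_below :: "int \<Rightarrow> 'a::order set \<Rightarrow> bool" where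
  "acyclic_below n R \<longleftrightarrow> (\<forall>i<n. cycles (order_complex R) i \<subseteq> boundaries (order_complex R) i)"

text \<open>Cycles rather than homology classes: the notion passes to larger posets, and in the top
  degree, where 0 is the only boundary, a nonzero cycle is a nonzero class.\<close>

definition has_cycle :: "int \<Rightarrow> 'a::order set \<Rightarrow> bool" where
  "has_cycle n R \<longleftrightarrow> (\<exists>z\<in>cycles (order_complex R) n. z \<noteq> 0)"

text \<open>By the homotopy formula the boundary of \<open>z\<close> is
  \<open>boundary a + w - cone q (boundary w)\<close>. The part without \<open>q\<close> and the
  part with \<open>q\<close> vanish separately.\<close>

lemma cycle_decomposition:
  assumes z: "z \<in> cycles (order_complex (insert q R)) i" and q: "q \<notin> R"
  obtains a w where "z = a + cone q w" "a \<in> chain_space (order_complex R) i"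
    "w \<in> cycles (order_complex (link R q)) (i - 1)" "boundary a + w = 0"
proof -
  obtain a w where za: "z = a + cone q w" and a: "a \<in> chain_space (order_complex R) i"
    and w: "w \<in> chain_space (order_complex (link R q)) (i - 1)"
    using cone_decomposition [of z q R i] z by (auto simp: cycles_def)
  have "boundary a + w - cone q (boundary w) = 0"
    using z by (simp add: cycles_def za boundary_add boundary_cone_link [OF w] add_diff_eq)
  then have eq: "boundary a + w = cone q (boundary w)" by simp
  have "boundary a + w \<in> chain_space (order_complex R) (i - 1)"
    by (intro chain_space_add boundary_chain_space [OF a] chain_space_mono [OF link_subset w])
  then have "boundary a + w = 0" "boundary w = 0"
    using cone_direct_sum [OF _ _ eq] chain_space_not_mem [OF _ q]
      chain_space_not_mem [OF boundary_chain_space [OF w] not_mem_link] by blast+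
  then show thesis
    using that [OF za a] w by (auto simp: cycles_def)
qed

text \<open>The Mayer-Vietoris argument for gluing a cone along the link, with explicit chains:
  \<open>w\<close> bounds some \<open>u\<close> in the link, then \<open>a + u\<close> is a cycle of
  \<open>R\<close> and bounds some \<open>v\<close>.\<close>

lemma acyclic_below_insert:
  assumes R: "acyclic_below n R" and q: "q \<notin> R" and L: "acyclic_below (n - 1) (link R q)"
  shows "acyclic_below n (insert q R)"
  unfolding acyclic_below_def
proof (intro allI impI subsetI)
  fix i z assume i: "i < n" and z: "z \<in> cycles (order_complex (insert q R)) i"
  then obtain a w where za: "z = a + cone q w" and a: "a \<in> chain_space (order_complex R) i"
    and w: "w \<in> cycles (order_complex (link R q)) (i - 1)" and "boundary a + w = 0"
    using cycle_decomposition [OF z q] by metis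
  from L i have "cycles (order_complex (link R q)) (i - 1) \<subseteq> boundaries (order_complex (link R q)) (i - 1)"
    by (simp add: acyclic_below_def)
  with w have "w \<in> boundaries (order_complex (link R q)) (i - 1)" by blast
  then obtain u where u: "u \<in> chain_space (order_complex (link R q)) i" and wu: "w = boundary u"
    by (auto simp: boundaries_def)
  have "u \<in> chain_space (order_complex R) i"
    by (rule chain_space_mono [OF link_subset u])
  then have "a + u \<in> cycles (order_complex R) i"
    using a \<open>boundary a + w = 0\<close> by (auto simp: cycles_def boundary_add wu intro: chain_space_add)
  then obtain v where v: "v \<in> chain_space (order_complex R) (i + 1)" and av: "a + u = boundary v"
    using R i by (fastforce simp: acyclic_below_def boundaries_def)
  \<comment> \<open>The correction \<open>cone q u\<close> has boundary \<open>u - cone q w\<close>,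
    so it removes \<open>u\<close> from \<open>a + u\<close> and supplies the cone part of
    \<open>z\<close>.\<close>
  have "z = boundary (v - cone q u)"
    by (simp add: za boundary_diff av [symmetric] boundary_cone_link [OF u] wu)
  moreover have "v - cone q u \<in> chain_space (order_complex (insert q R)) (i + 1)"
    using v cone_chain_space [OF u] chain_space_mono [of R "insert q R"]
    by (auto intro: chain_space_diff)
  ultimately show "z \<in> boundaries (order_complex (insert q R)) i"
    by (auto simp: boundaries_def)
qed

text \<open>The cycle \<open>w\<close> of the link is the boundary of \<open>cone q w\<close> and,
  by acyclicity, of a chain \<open>u\<close> in \<open>R\<close>. The difference of the two chains
  is a cycle, nonzero because only the first one involves \<open>q\<close>.\<close>

lemma has_cycle_insert:
  assumes R: "acyclic_below n R" and q: "q \<notin> R" and L: "has_cycle (n - 1) (link R q)"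
  shows "has_cycle n (insert q R)"
proof -
  from L obtain w where w: "w \<in> chain_space (order_complex (link R q)) (n - 1)"
    "boundary w = 0" "w \<noteq> 0"
    by (auto simp: has_cycle_def cycles_def)
  then have "w \<in> cycles (order_complex R) (n - 1)"
    using chain_space_mono [OF link_subset] by (auto simp: cycles_def)
  moreover have "cycles (order_complex R) (n - 1) \<subseteq> boundaries (order_complex R) (n - 1)"
    using R by (simp add: acyclic_below_def)
  ultimately have "w \<in> boundaries (order_complex R) (n - 1)" by blast
  then obtain u where u: "u \<in> chain_space (order_complex R) n" and wu: "w = boundary u"
    by (auto simp: boundaries_def)
  have "boundary (cone q w - u) = 0"
    using w(2) wu boundary_cone_link [OF w(1)] by (simp add: boundary_diff)
  moreover have "cone q w - u \<in> chain_space (order_complex (insert q R)) n"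
    using u cone_chain_space [OF w(1)] chain_space_mono [of R "insert q R"]
    by (auto intro: chain_space_diff)
  moreover have "cone q w - u \<noteq> 0"
  proof
    assume "cone q w - u = 0"
    then have eq: "u = cone q w" by simp
    show False
      using cone_direct_sum(2) [OF _ _ eq] chain_space_not_mem [OF u q]
        chain_space_not_mem [OF w(1) not_mem_link] \<open>w \<noteq> 0\<close> by blast
  qed
  ultimately show ?thesis
    by (auto simp: has_cycle_def cycles_def)
qed

lemma has_cycle_mono: "has_cycle n R \<Longrightarrow> R \<subseteq> S \<Longrightarrow> has_cycle n S"
  unfolding has_cycle_def cycles_def using chain_space_mono by blast

text \<open>An element comparable to all others makes the order complex a cone, which is
  contractible; hence \<open>n\<close> is arbitrary.\<close>

lemma acyclic_below_apex:
  assumes c: "c \<in> R" and comp: "\<And>r. r \<in> R \<Longrightarrow> r \<le> c \<or> c \<le> r"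
  shows "acyclic_below n R"
  unfolding acyclic_below_def
proof (intro allI impI subsetI)
  let ?R = "R - {c}"
  have R: "insert c ?R = R" and c': "c \<notin> ?R" using c by auto
  have L: "link ?R c = ?R" using comp by (fastforce simp: link_def)
  fix i z assume "z \<in> cycles (order_complex R) i"
  then have z: "z \<in> cycles (order_complex (insert c ?R)) i" by (simp only: R)
  obtain a w where za: "z = a + cone c w" and a: "a \<in> chain_space (order_complex ?R) i"
    and w: "boundary a + w = 0"
    using cycle_decomposition [OF z c'] by metis
  \<comment> \<open>With this value of \<open>w\<close>, the homotopy formula identifies
    \<open>z\<close> with the boundary of \<open>cone c a\<close>.\<close>
  have wa: "w = - boundary a" using w by (simp add: add_eq_0_iff)
  have a': "a \<in> chain_space (order_complex (link ?R c)) i" using a L by simp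
  have "cone c w = - cone c (boundary a)"
    using cone_diff [of c 0 "boundary a"] by (simp add: wa)
  then have "z = boundary (cone c a)"
    by (simp add: boundary_cone_link [OF a'] za)
  then show "z \<in> boundaries (order_complex R) i"
    using cone_chain_space [OF a'] R by (auto simp: boundaries_def)
qed

text \<open>The empty face sits in degree -1, and there are no faces below. With
  \<open>has_cycle_minus_one\<close> this is the start of the inductions on the rank.\<close>

lemma acyclic_below_minus_one: "acyclic_below (-1) R"
  unfolding acyclic_below_def
proof (intro allI impI subsetI)
  fix i :: int and z assume "i < -1" "z \<in> cycles (order_complex R) i"
  moreover have "faces (order_complex R) i = {}"
    using \<open>i < -1\<close> by (auto simp: faces_def)
  ultimately have "z = boundary 0" by (simp add: cycles_def chain_space_def)
  then show "z \<in> boundaries (order_complex R) i"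
    unfolding boundaries_def using chain_space_0 by blast
qed

text \<open>The cycle is the empty face, present even when \<open>R\<close> is empty.\<close>

lemma has_cycle_minus_one: "has_cycle (-1) R"
  unfolding has_cycle_def
  by (rule bexI [of _ "Poly_Mapping.single {} 1"])
    (auto simp: cycles_def chain_space_def boundary_single simplex_boundary_def
      faces_order_complex_iff dest: arg_cong [of _ _ "\<lambda>c. Poly_Mapping.lookup c {}"])

text \<open>Each new vertex is inserted along a link, possibly empty, on which this degree imposes
  no condition.\<close>

lemma acyclic_below_0:
  assumes "finite R" "R \<noteq> {}"
  shows "acyclic_below 0 R"
  using assms
proof (induction R rule: finite_ne_induct)
  case (singleton x)
  then show ?case by (auto intro: acyclic_below_apex)
next
  case (insert x F)
  then show ?case using acyclic_below_insert [of 0 F x] acyclic_below_minus_one by auto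
qed

text \<open>The cycle is in effect the difference of the two points: \<open>v\<close> is inserted
  after \<open>u\<close>, with the empty face as cycle of the link.\<close>

lemma has_cycle_0:
  assumes "u \<in> R" "v \<in> R" "u \<noteq> v"
  shows "has_cycle 0 R"
proof (rule has_cycle_mono)
  have "acyclic_below 0 {u}" by (rule acyclic_below_0) auto
  then show "has_cycle 0 (insert v {u})"
    by (rule has_cycle_insert) (use assms has_cycle_minus_one in auto)
qed (use assms in auto)

text \<open>The elements of \<open>Q\<close> are inserted from the largest to the smallest. The hypothesis says that the
  link of \<open>q\<close> is a cone at the time when \<open>q\<close> is inserted.\<close>

lemma acyclic_below_union_desc:
  assumes "finite Q" "R \<inter> Q = {}" "acyclic_below n R"
    and "\<And>q. q \<in> Q \<Longrightarrow> \<exists>c \<in> link R q \<union> {p\<in>Q. q < p}.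
      \<forall>r \<in> link R q \<union> {p\<in>Q. q < p}. r \<le> c \<or> c \<le> r"
  shows "acyclic_below n (R \<union> Q)"
  using assms
proof (induction "card Q" arbitrary: Q)
  case 0
  then show ?case by simp
next
  case (Suc k)
  then have "Q \<noteq> {}" by auto
  \<comment> \<open>A minimal element is the last to be inserted, so its removal changes none of the
    sets \<open>{p\<in>Q. x < p}\<close> in the hypothesis.\<close>
  then obtain q where q: "q \<in> Q" and min: "\<And>p. p \<in> Q \<Longrightarrow> \<not> p < q"
    using finite_has_minimal [of Q] Suc.prems(1) by (metis less_le)
  have Q: "{p\<in>Q - {q}. x < p} = {p\<in>Q. x < p}" if "x \<in> Q" for x
    using min that by auto
  have IH: "acyclic_below n (R \<union> (Q - {q}))"
  proof (rule Suc.hyps(1))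
    show "k = card (Q - {q})" "finite (Q - {q})" using Suc q by auto
    show "R \<inter> (Q - {q}) = {}" "acyclic_below n R" using Suc.prems by auto
    fix x assume "x \<in> Q - {q}"
    then have x: "x \<in> Q" by simp
    show "\<exists>c \<in> link R x \<union> {p\<in>Q - {q}. x < p}. \<forall>r \<in> link R x \<union> {p\<in>Q - {q}. x < p}. r \<le> c \<or> c \<le> r"
      unfolding Q [OF x] by (rule Suc.prems(4) [OF x])
  qed
  have L: "link (R \<union> (Q - {q})) q = link R q \<union> {p\<in>Q. q < p}"
    using min by (auto simp: link_def)
  have "acyclic_below (n - 1) (link (R \<union> (Q - {q})) q)"
    unfolding L using Suc.prems(4) [OF q] by (auto intro: acyclic_below_apex)
  then have "acyclic_below n (insert q (R \<union> (Q - {q})))"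
    using IH Suc.prems(2) q by (intro acyclic_below_insert) auto
  also have "insert q (R \<union> (Q - {q})) = R \<union> Q" using q by auto
  finally show ?case .
qed

text \<open>The mirror image of \<open>acyclic_below_union_desc\<close>: the elements of
  \<open>Q\<close> enter from the smallest to the largest, so \<open>q\<close> meets
  \<open>R\<close> and the smaller elements of \<open>Q\<close>.\<close>

lemma acyclic_below_union_asc:
  assumes "finite Q" "R \<inter> Q = {}" "acyclic_below n R"
    and "\<And>q. q \<in> Q \<Longrightarrow> \<exists>c \<in> link R q \<union> {p\<in>Q. p < q}.
      \<forall>r \<in> link R q \<union> {p\<in>Q. p < q}. r \<le> c \<or> c \<le> r"
  shows "acyclic_below n (R \<union> Q)"
  using assms
proof (induction "card Q" arbitrary: Q)
  case 0
  then show ?case by simp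
next
  case (Suc k)
  then have "Q \<noteq> {}" by auto
  then obtain q where q: "q \<in> Q" and max: "\<And>p. p \<in> Q \<Longrightarrow> \<not> q < p"
    using finite_has_maximal [of Q] Suc.prems(1) by (metis less_le)
  have Q: "{p\<in>Q - {q}. p < x} = {p\<in>Q. p < x}" if "x \<in> Q" for x
    using max that by auto
  have IH: "acyclic_below n (R \<union> (Q - {q}))"
  proof (rule Suc.hyps(1))
    show "k = card (Q - {q})" "finite (Q - {q})" using Suc q by auto
    show "R \<inter> (Q - {q}) = {}" "acyclic_below n R" using Suc.prems by auto
    fix x assume "x \<in> Q - {q}"
    then have x: "x \<in> Q" by simp
    show "\<exists>c \<in> link R x \<union> {p\<in>Q - {q}. p < x}. \<forall>r \<in> link R x \<union> {p\<in>Q - {q}. p < x}. r \<le> c \<or> c \<le> r"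
      unfolding Q [OF x] by (rule Suc.prems(4) [OF x])
  qed
  have L: "link (R \<union> (Q - {q})) q = link R q \<union> {p\<in>Q. p < q}"
    using max by (auto simp: link_def)
  have "acyclic_below (n - 1) (link (R \<union> (Q - {q})) q)"
    unfolding L using Suc.prems(4) [OF q] by (auto intro: acyclic_below_apex)
  then have "acyclic_below n (insert q (R \<union> (Q - {q})))"
    using IH Suc.prems(2) q by (intro acyclic_below_insert) auto
  also have "insert q (R \<union> (Q - {q})) = R \<union> Q" using q by auto
  finally show ?case .
qed


section \<open>Betti numbers of order complexes from acyclicity and cycles\<close>

lemma reduced_betti_eq_0:
  assumes "acyclic_below n R" "i < n"
  shows "reduced_betti (order_complex R) i = 0"
proof -
  have "boundaries (order_complex R) i \<subseteq> cycles (order_complex R) i"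
    by (rule boundaries_subset_cycles) (auto simp: order_complex_def pred_on.chain_def intro: finite_subset)
  then have "cycles (order_complex R) i = boundaries (order_complex R) i"
    using assms by (auto simp: acyclic_below_def)
  then show ?thesis by (simp add: reduced_betti_def)
qed

text \<open>By the bound on chains there are no faces in degree \<open>n + 1\<close>, so 0 is the
  only boundary in degree \<open>n\<close> and the Betti number is the dimension of the cycle
  space.\<close>

lemma reduced_betti_top_neq_0:
  fixes R :: "'a::order set"
  assumes fin: "finite R" and cyc: "has_cycle n R"
    and dim: "\<And>C. C \<in> order_complex R \<Longrightarrow> int (card C) \<le> n + 1"
  shows "reduced_betti (order_complex R) n \<noteq> 0"
proof -
  let ?Z = "cycles (order_complex R) n"
  let ?F = "(\<lambda>s. Poly_Mapping.single s (1::complex)) ` faces (order_complex R) n"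
  have "faces (order_complex R) (n + 1) = {}"
    using dim by (force simp: faces_def)
  then have "boundaries (order_complex R) n = {0}"
    by (auto simp: boundaries_def chain_space_def)
  then have B: "cchain.dim (boundaries (order_complex R) n) = 0"
    using cchain.dim_eq_card [of "{}" "{0 :: 'a cchain}"] by (simp add: cchain.independent_empty)
  have "finite (faces (order_complex R) n)"
    by (rule finite_subset [of _ "Pow R"]) (use fin in \<open>auto simp: faces_order_complex_iff\<close>)
  then have finF: "finite ?F" by simp
  \<comment> \<open>Finite dimension matters here: \<open>cchain.dim\<close> is the cardinality of a
    basis, which would be 0 if the basis were infinite.\<close>
  have Z: "?Z \<subseteq> cchain.span ?F"
  proof
    fix z assume "z \<in> ?Z"
    then have K: "Poly_Mapping.keys z \<subseteq> faces (order_complex R) n"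
      by (simp add: cycles_def chain_space_def)
    have "z = (\<Sum>s\<in>Poly_Mapping.keys z. scale_cchain (Poly_Mapping.lookup z s) (Poly_Mapping.single s 1))"
      using poly_mapping_sum_single [of z] by (simp add: scale_single)
    also have "\<dots> \<in> cchain.span ?F"
      using K by (intro cchain.span_sum cchain.span_scale cchain.span_base) auto
    finally show "z \<in> cchain.span ?F" .
  qed
  obtain z where z: "z \<in> ?Z" "z \<noteq> 0" using cyc by (auto simp: has_cycle_def)
  obtain b where b: "b \<subseteq> ?Z" "cchain.independent b" "?Z \<subseteq> cchain.span b" "card b = cchain.dim ?Z"
    using cchain.basis_exists by blast
  have "finite b"
    using cchain.independent_span_bound [OF finF b(2)] b(1) Z by auto
  moreover have "b \<noteq> {}" using b(3) z by auto
  ultimately have "cchain.dim ?Z > 0" using b(4) by (metis card_gt_0_iff)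
  then show ?thesis by (simp add: reduced_betti_def B)
qed


section \<open>Ranked posets\<close>

lemma chain_rank_inj:
  fixes \<rho> :: "'a::order \<Rightarrow> nat"
  assumes "pred_on.chain Q (<) C" and "\<And>x y. x \<in> Q \<Longrightarrow> y \<in> Q \<Longrightarrow> x < y \<Longrightarrow> \<rho> x < \<rho> y"
  shows "inj_on \<rho> C"
  using assms unfolding inj_on_def pred_on.chain_def by (fastforce simp: subset_iff)

text \<open>A maximal chain takes every rank between those of \<open>b\<close> and \<open>t\<close>:
  at a missing rank \<open>k\<close>, the neighbours of the gap leave room for an element of
  \<open>Q\<close>, and this would extend the chain.\<close>

lemma maxchain_card:
  fixes \<rho> :: "'a::order \<Rightarrow> nat"
  assumes C: "pred_on.maxchain Q (<) C" and fin: "finite Q"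
    and b: "b \<in> Q" "\<And>x. x \<in> Q \<Longrightarrow> b \<le> x" and t: "t \<in> Q" "\<And>x. x \<in> Q \<Longrightarrow> x \<le> t"
    and mono: "\<And>x y. x \<in> Q \<Longrightarrow> y \<in> Q \<Longrightarrow> x < y \<Longrightarrow> \<rho> x < \<rho> y"
    and cover: "\<And>x y. x \<in> Q \<Longrightarrow> y \<in> Q \<Longrightarrow> x < y \<Longrightarrow> Suc (\<rho> x) < \<rho> y \<Longrightarrow> \<exists>z\<in>Q. x < z \<and> z < y"
  shows "card C = Suc (\<rho> t) - \<rho> b"
proof -
  have chain: "pred_on.chain Q (<) C" and CQ: "C \<subseteq> Q"
    and tot: "\<And>x y. x \<in> C \<Longrightarrow> y \<in> C \<Longrightarrow> x < y \<or> x = y \<or> y < x"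
    using C by (auto simp: pred_on.maxchain_def pred_on.chain_def)
  have max: "x \<in> C" if "x \<in> Q" "\<And>y. y \<in> C \<Longrightarrow> x < y \<or> x = y \<or> y < x" for x
  proof (rule ccontr)
    assume "x \<notin> C"
    moreover have "pred_on.chain Q (<) (insert x C)"
      using that CQ tot by (auto simp: pred_on.chain_def)
    ultimately show False
      using C by (auto simp: pred_on.maxchain_def)
  qed
  have finC: "finite C" using CQ fin by (rule finite_subset)
  have rho_le: "\<rho> x \<le> \<rho> y" if "x \<in> Q" "y \<in> Q" "x \<le> y" for x y
    using mono [OF that(1,2)] that(3) by (metis le_less)
  have bC: "b \<in> C" using max [OF b(1)] b(2) CQ by (auto simp: order.order_iff_strict subset_iff)
  have tC: "t \<in> C" using max [OF t(1)] t(2) CQ by (auto simp: order.order_iff_strict subset_iff)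
  have "\<rho> ` C = {\<rho> b..\<rho> t}"
  proof (intro equalityI subsetI)
    fix k assume "k \<in> \<rho> ` C"
    then show "k \<in> {\<rho> b..\<rho> t}" using CQ b t rho_le by auto
  next
    fix k assume k: "k \<in> {\<rho> b..\<rho> t}"
    show "k \<in> \<rho> ` C"
    proof (rule ccontr)
      assume nk: "k \<notin> \<rho> ` C"
      let ?L = "{x\<in>C. \<rho> x < k}" and ?U = "{x\<in>C. k < \<rho> x}"
      have "b \<in> ?L" "t \<in> ?U" using k nk bC tC by (auto simp: order.order_iff_strict)
      then have "?L \<noteq> {}" "?U \<noteq> {}" by blast+
      then obtain l u where l: "l \<in> ?L" "\<forall>x\<in>?L. l \<le> x \<longrightarrow> l = x"
        and u: "u \<in> ?U" "\<forall>x\<in>?U. x \<le> u \<longrightarrow> u = x"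
        using finite_has_maximal [of ?L] finite_has_minimal [of ?U] finC by auto
      have lu: "l < u" using tot [of l u] l u mono [of u l] CQ by force
      obtain z where z: "z \<in> Q" "l < z" "z < u"
        using cover [of l u] lu l u CQ by auto
      have "z \<in> C"
      proof (rule max [OF z(1)])
        fix y assume y: "y \<in> C"
        then have "\<rho> y < k \<or> k < \<rho> y" using nk by (metis image_eqI nat_neq_iff)
        then show "z < y \<or> z = y \<or> y < z"
        proof
          assume "\<rho> y < k"
          then have "y \<le> l" using tot [of y l] l y by fastforce
          then show ?thesis using z(2) by auto
        next
          assume "k < \<rho> y"
          then have "u \<le> y" using tot [of y u] u y by fastforce
          then show ?thesis using z(3) by auto
        qed
      qed
      moreover from this have "\<rho> z < k \<or> k < \<rho> z" using nk by (metis image_eqI nat_neq_iff)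
      ultimately show False using l u z by fastforce
    qed
  qed
  moreover have "card (\<rho> ` C) = card C"
    using card_image [OF chain_rank_inj [OF chain mono]] by simp
  ultimately show ?thesis by simp
qed

text \<open>The rank difference minus 2 bounds the dimension of the open interval from above, so
  acyclicity below this number covers all degrees below the dimension, without computing the
  latter.\<close>

lemma cohen_macaulayI:
  fixes \<rho> :: "'a::order \<Rightarrow> nat"
  assumes fin: "finite Q"
    and b: "b \<in> Q" "\<And>x. x \<in> Q \<Longrightarrow> b \<le> x" and t: "t \<in> Q" "\<And>x. x \<in> Q \<Longrightarrow> x \<le> t"
    and mono: "\<And>x y. x \<in> Q \<Longrightarrow> y \<in> Q \<Longrightarrow> x < y \<Longrightarrow> \<rho> x < \<rho> y"
    and cover: "\<And>x y. x \<in> Q \<Longrightarrow> y \<in> Q \<Longrightarrow> x < y \<Longrightarrow> Suc (\<rho> x) < \<rho> y \<Longrightarrow> \<exists>z\<in>Q. x < z \<and> z < y"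
    and acyclic: "\<And>x y. x \<in> Q \<Longrightarrow> y \<in> Q \<Longrightarrow> x < y \<Longrightarrow>
      acyclic_below (int (\<rho> y) - int (\<rho> x) - 2) (Q \<inter> {x<..<y})"
  shows "cohen_macaulay Q"
  unfolding cohen_macaulay_def
proof (intro conjI ballI impI allI)
  have "\<And>C. pred_on.maxchain Q (<) C \<Longrightarrow> card C = Suc (\<rho> t) - \<rho> b"
    by (rule maxchain_card [where \<rho> = \<rho>, OF _ fin b t mono cover])
  then show "graded_poset Q"
    unfolding graded_poset_def using fin b t by auto
next
  fix x y i assume x: "x \<in> Q" and y: "y \<in> Q" and xy: "x < y"
    and i: "i < complex_dim (order_complex (Q \<inter> {x<..<y}))"
  let ?P = "Q \<inter> {x<..<y}"
  have card: "int (card s) - 1 \<le> int (\<rho> y) - int (\<rho> x) - 2" if "s \<in> order_complex ?P" for s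
  proof -
    have s: "pred_on.chain ?P (<) s" using that by (simp add: order_complex_def)
    then have "inj_on \<rho> s" by (rule chain_rank_inj) (use mono in auto)
    moreover have "\<rho> ` s \<subseteq> {\<rho> x<..<\<rho> y}"
    proof
      fix k assume "k \<in> \<rho> ` s"
      moreover have "s \<subseteq> ?P" using s by (simp add: pred_on.chain_def)
      ultimately obtain z where "z \<in> ?P" "k = \<rho> z" by blast
      then show "k \<in> {\<rho> x<..<\<rho> y}" using mono [OF x, of z] mono [OF _ y, of z] by simp
    qed
    ultimately have "card s \<le> card {\<rho> x<..<\<rho> y}"
      by (metis card_image card_mono finite_greaterThanLessThan)
    then show ?thesis using mono [OF x y xy] by simp
  qed
  have "finite (order_complex ?P)"
    by (rule finite_subset [of _ "Pow Q"]) (use fin in \<open>auto simp: order_complex_def pred_on.chain_def\<close>)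
  moreover have "{} \<in> order_complex ?P"
    by (simp add: order_complex_def pred_on.chain_def)
  ultimately have "complex_dim (order_complex ?P) \<le> int (\<rho> y) - int (\<rho> x) - 2"
    unfolding complex_dim_def using card by (subst Max_le_iff) auto
  then show "reduced_betti (order_complex ?P) i = 0"
    using reduced_betti_eq_0 [OF acyclic [OF x y xy]] i by simp
qed


section \<open>Boolean intervals of groups\<close>

text \<open>The isomorphism is fixed in the direction from index sets to subgroups: the
  \<open>e {i}\<close> are the atoms, \<open>e (S - {i})\<close> is the complement of
  \<open>e {i}\<close> below \<open>e S\<close>, and meets become intersections of index
  sets.\<close>

locale boolean_interval = group G for G (structure) +
  fixes H :: "'a set" and m :: nat and e :: "nat set \<Rightarrow> 'a set"
  assumes fin: "finite (carrier G)"
    and subgroup_H: "subgroup H G"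
    and bij: "bij_betw e (Pow {..<m}) (group_interval G H)"
    and e_le_iff: "\<And>S T. S \<subseteq> {..<m} \<Longrightarrow> T \<subseteq> {..<m} \<Longrightarrow> e S \<subseteq> e T \<longleftrightarrow> S \<subseteq> T"
begin

section \<open>Subgroups of the interval as sets of atoms\<close>

lemma e_subgroup: "S \<subseteq> {..<m} \<Longrightarrow> subgroup (e S) G"
  and e_ge: "S \<subseteq> {..<m} \<Longrightarrow> H \<subseteq> e S"
  using bij_betwE [OF bij] by (auto simp: group_interval_def)

lemma e_carrier: "S \<subseteq> {..<m} \<Longrightarrow> e S \<subseteq> carrier G"
  by (rule subgroup.subset [OF e_subgroup])

lemma e_surj:
  assumes "subgroup K G" "H \<subseteq> K"
  obtains S where "S \<subseteq> {..<m}" "K = e S"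
proof -
  have "K \<in> e ` Pow {..<m}"
    using assms bij by (simp add: bij_betw_def group_interval_def)
  then show thesis using that by auto
qed

lemma e_empty: "e {} = H"
proof -
  obtain S where S: "S \<subseteq> {..<m}" "H = e S" using e_surj [OF subgroup_H] by auto
  then have "S \<subseteq> {}" using e_le_iff [of S "{}"] e_ge [of "{}"] by auto
  then show ?thesis using S by auto
qed

lemma e_full: "e {..<m} = carrier G"
proof -
  obtain S where S: "S \<subseteq> {..<m}" "carrier G = e S"
    using e_surj [OF subgroup_self] subgroup.subset [OF subgroup_H] by auto
  then show ?thesis using e_le_iff [of S "{..<m}"] e_carrier [of "{..<m}"] by auto
qed

text \<open>The intersection of two members of the interval is again a member, hence their meet, and
  an order isomorphism preserves meets.\<close>

lemma e_Int:
  assumes S: "S \<subseteq> {..<m}" and T: "T \<subseteq> {..<m}"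
  shows "e S \<inter> e T = e (S \<inter> T)"
proof
  have ST: "S \<inter> T \<subseteq> {..<m}" using S by auto
  show "e (S \<inter> T) \<subseteq> e S \<inter> e T"
    using e_le_iff [OF ST S] e_le_iff [OF ST T] by auto
  obtain U where U: "U \<subseteq> {..<m}" "e S \<inter> e T = e U"
    using e_surj [OF subgroups_Inter_pair [OF e_subgroup [OF S] e_subgroup [OF T]]]
      e_ge [OF S] e_ge [OF T] by blast
  then have "U \<subseteq> S \<inter> T" using e_le_iff [OF U(1) S] e_le_iff [OF U(1) T] by auto
  then show "e S \<inter> e T \<subseteq> e (S \<inter> T)" using U e_le_iff [OF U(1) ST] by auto
qed

text \<open>The equivalence relation on the group whose classes are the right cosets of
  \<open>e S\<close>. Inclusions between cosets become statements about this relation and about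
  index sets.\<close>

definition near :: "nat set \<Rightarrow> 'a \<Rightarrow> 'a \<Rightarrow> bool" where
  "near S x y \<longleftrightarrow> x \<in> carrier G \<and> y \<in> carrier G \<and> x \<otimes> inv y \<in> e S"

definition coset :: "nat set \<Rightarrow> 'a \<Rightarrow> 'a set" where
  "coset S x = e S #> x"

lemma near_carrier: "near S x y \<Longrightarrow> x \<in> carrier G" "near S x y \<Longrightarrow> y \<in> carrier G"
  by (auto simp: near_def)

lemma near_refl: "S \<subseteq> {..<m} \<Longrightarrow> x \<in> carrier G \<Longrightarrow> near S x x"
  by (simp add: near_def subgroup.one_closed [OF e_subgroup])

lemma near_sym: "S \<subseteq> {..<m} \<Longrightarrow> near S x y \<Longrightarrow> near S y x"
  using subgroup.m_inv_closed [OF e_subgroup, of S "x \<otimes> inv y"]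
  by (simp add: near_def inv_mult_group)

lemma near_trans:
  assumes S: "S \<subseteq> {..<m}" and xy: "near S x y" and yz: "near S y z"
  shows "near S x z"
proof -
  have c: "x \<in> carrier G" "y \<in> carrier G" "z \<in> carrier G"
    using xy yz by (auto simp: near_def)
  have "(x \<otimes> inv y) \<otimes> (y \<otimes> inv z) = x \<otimes> inv z"
    using c by (metis inv_closed inv_solve_left m_assoc m_closed)
  moreover have "(x \<otimes> inv y) \<otimes> (y \<otimes> inv z) \<in> e S"
    using xy yz subgroup.m_closed [OF e_subgroup [OF S]] by (simp add: near_def)
  ultimately show ?thesis using c by (simp add: near_def)
qed

lemma near_mono: "S \<subseteq> T \<Longrightarrow> T \<subseteq> {..<m} \<Longrightarrow> near S x y \<Longrightarrow> near T x y"
  using e_le_iff [of S T] by (auto simp: near_def)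

lemma near_Int: "S \<subseteq> {..<m} \<Longrightarrow> T \<subseteq> {..<m} \<Longrightarrow> near S x y \<Longrightarrow> near T x y \<Longrightarrow> near (S \<inter> T) x y"
  by (auto simp: near_def simp flip: e_Int)

lemma near_full: "near {..<m} x y \<longleftrightarrow> x \<in> carrier G \<and> y \<in> carrier G"
  by (auto simp: near_def e_full)

lemma mem_coset_iff:
  assumes S: "S \<subseteq> {..<m}" and x: "x \<in> carrier G"
  shows "y \<in> coset S x \<longleftrightarrow> near S y x"
proof -
  interpret K: subgroup "e S" G by (rule e_subgroup [OF S])
  have "coset S x \<subseteq> carrier G"
    unfolding coset_def by (rule r_coset_subset_G [OF K.subset x])
  then show ?thesis
    unfolding coset_def near_def using K.rcos_module [OF is_group x] x by blast
qed

text \<open>A coset determines its subgroup: an element \<open>k\<close> of \<open>e S\<close> is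
  the quotient of \<open>k \<otimes> x\<close> and \<open>x\<close>, which both lie in
  \<open>coset S x\<close>. So index set and class are faithful coordinates on the coset
  poset.\<close>

lemma coset_le_iff:
  assumes S: "S \<subseteq> {..<m}" and T: "T \<subseteq> {..<m}" and x: "x \<in> carrier G" and y: "y \<in> carrier G"
  shows "coset S x \<subseteq> coset T y \<longleftrightarrow> S \<subseteq> T \<and> near T x y"
proof
  assume le: "coset S x \<subseteq> coset T y"
  have xy: "near T x y"
    using le mem_coset_iff [OF S x, of x] mem_coset_iff [OF T y, of x] near_refl [OF S x] by auto
  have "k \<in> e T" if k: "k \<in> e S" for k
  proof -
    have kc: "k \<in> carrier G" using k e_carrier [OF S] by auto
    have "near S (k \<otimes> x) x" using k kc x by (simp add: near_def m_assoc)
    then have "near T (k \<otimes> x) y"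
      using le mem_coset_iff [OF S x] mem_coset_iff [OF T y] by auto
    then have "near T (k \<otimes> x) x" using near_trans [OF T] near_sym [OF T] xy by blast
    then show ?thesis using kc x by (simp add: near_def m_assoc)
  qed
  then show "S \<subseteq> T \<and> near T x y" using xy e_le_iff [OF S T] by auto
next
  assume "S \<subseteq> T \<and> near T x y"
  then show "coset S x \<subseteq> coset T y"
    using mem_coset_iff [OF S x] mem_coset_iff [OF T y] near_mono [OF _ T, of S] near_trans [OF T]
    by blast
qed

lemma coset_eq_iff:
  assumes S: "S \<subseteq> {..<m}" and T: "T \<subseteq> {..<m}" and x: "x \<in> carrier G" and y: "y \<in> carrier G"
  shows "coset S x = coset T y \<longleftrightarrow> S = T \<and> near T x y"
  using coset_le_iff [OF S T x y] coset_le_iff [OF T S y x] near_sym by (metis S subset_antisym subset_refl)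

lemma coset_less_iff:
  assumes S: "S \<subseteq> {..<m}" and T: "T \<subseteq> {..<m}" and x: "x \<in> carrier G" and y: "y \<in> carrier G"
  shows "coset S x \<subset> coset T y \<longleftrightarrow> S \<subset> T \<and> near T x y"
  using coset_le_iff [OF assms] coset_eq_iff [OF assms] by auto

lemma ex_near_not_near:
  assumes S: "S \<subseteq> {..<m}" and T: "T \<subset> S" and x: "x \<in> carrier G"
  obtains y where "near S y x" "\<not> near T y x"
proof -
  have T': "T \<subseteq> {..<m}" using S T by auto
  have "\<not> coset S x \<subseteq> coset T x" using coset_le_iff [OF S T' x x] T by auto
  then show thesis using that mem_coset_iff [OF S x] mem_coset_iff [OF T' x] by auto
qed

text \<open>The atoms \<open>e {k}\<close> with \<open>k \<in> S\<close> generate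
  \<open>e S\<close>, because a subgroup of the interval containing them all is \<open>e U\<close>
  for some \<open>U\<close> with \<open>S \<subseteq> U\<close>. This is the connectedness argument
  for rank 2.\<close>

lemma near_induct:
  assumes S: "S \<subseteq> {..<m}" "S \<noteq> {}" and xy: "near S y x" and x: "x \<in> T" and T: "T \<subseteq> carrier G"
    and closed: "\<And>k x y. k \<in> S \<Longrightarrow> x \<in> T \<Longrightarrow> near {k} y x \<Longrightarrow> y \<in> T"
  shows "y \<in> T"
proof -
  \<comment> \<open>The stabiliser of \<open>T\<close> under left multiplication. It has inverses
    because an injective map of a finite set into itself is onto.\<close>
  define N where "N = {k\<in>carrier G. \<forall>x\<in>T. k \<otimes> x \<in> T}"
  have sub: "subgroup N G"
  proof (rule subgroupI)
    show "N \<noteq> {}" using T by (auto simp: N_def intro!: exI [of _ \<one>])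
    fix a assume a: "a \<in> N"
    have "inj_on ((\<otimes>) a) T"
      by (rule inj_onI) (use a T in \<open>auto simp: N_def subset_iff\<close>)
    moreover have "(\<otimes>) a ` T \<subseteq> T" using a by (auto simp: N_def)
    ultimately have aT: "(\<otimes>) a ` T = T"
      using fin T by (meson endo_inj_surj finite_subset)
    have "inv a \<otimes> z \<in> T" if "z \<in> T" for z
    proof -
      have "z \<in> (\<otimes>) a ` T" using aT that by simp
      then obtain w where w: "w \<in> T" "z = a \<otimes> w" by auto
      then have "inv a \<otimes> z = w" using a T by (auto simp: N_def m_assoc [symmetric])
      then show ?thesis using w by simp
    qed
    then show "inv a \<in> N" using a by (auto simp: N_def)
  next
    fix a b assume "a \<in> N" "b \<in> N"
    then show "a \<otimes> b \<in> N" using T by (auto simp: N_def m_assoc)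
  qed (auto simp: N_def)
  have eN: "e {k} \<subseteq> N" if k: "k \<in> S" for k
  proof
    fix a assume a: "a \<in> e {k}"
    have ac: "a \<in> carrier G" using a k S e_carrier [of "{k}"] by auto
    have "a \<otimes> z \<in> T" if "z \<in> T" for z
      using closed [OF k that, of "a \<otimes> z"] that T ac a by (auto simp: near_def m_assoc)
    then show "a \<in> N" using ac by (simp add: N_def)
  qed
  obtain k where "k \<in> S" using S by auto
  then have "H \<subseteq> N" using e_ge [of "{k}"] S eN [of k] by blast
  then obtain U where U: "U \<subseteq> {..<m}" "N = e U"
    by (rule e_surj [OF sub])
  have "k \<in> U" if "k \<in> S" for k
    using eN [OF that] U e_le_iff [of "{k}" U] S that by auto
  then have "e S \<subseteq> N" using U e_le_iff [OF S(1) U(1)] by auto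
  then have "y \<otimes> inv x \<otimes> x \<in> T" using xy x by (auto simp: near_def N_def)
  then show ?thesis using xy by (simp add: near_def m_assoc)
qed

text \<open>The open interval between \<open>coset T g\<close> and \<open>coset S g\<close>: all
  cosets in it contain \<open>g\<close>, so one representative serves for all. It is a copy of the
  proper part of a Boolean lattice.\<close>

definition coset_interval :: "nat set \<Rightarrow> nat set \<Rightarrow> 'a \<Rightarrow> 'a set set" where
  "coset_interval T S g = {coset U g | U. T \<subset> U \<and> U \<subset> S}"

text \<open>The open interval between the empty set and \<open>coset S g\<close>; its minimal
  members are cosets of \<open>H\<close>.\<close>

definition cosets_below :: "nat set \<Rightarrow> 'a \<Rightarrow> 'a set set" where
  "cosets_below S g = {coset T x | T x. T \<subset> S \<and> near S x g}"

lemma finite_coset_interval: "S \<subseteq> {..<m} \<Longrightarrow> finite (coset_interval T S g)"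
  unfolding coset_interval_def
  by (rule finite_subset [of _ "(\<lambda>U. coset U g) ` Pow {..<m}"]) auto

lemma finite_cosets: "finite {coset T x | T x. T \<subseteq> {..<m} \<and> x \<in> carrier G}"
proof -
  have "{coset T x | T x. T \<subseteq> {..<m} \<and> x \<in> carrier G}
      \<subseteq> (\<lambda>(T, x). coset T x) ` (Pow {..<m} \<times> carrier G)" by auto
  then show ?thesis by (rule finite_subset) (simp add: fin)
qed

lemma finite_cosets_below: "S \<subseteq> {..<m} \<Longrightarrow> finite (cosets_below S g)"
proof (rule finite_subset [OF _ finite_cosets])
  assume "S \<subseteq> {..<m}"
  then show "cosets_below S g \<subseteq> {coset T x | T x. T \<subseteq> {..<m} \<and> x \<in> carrier G}"
    unfolding cosets_below_def using near_carrier(1) by blast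
qed

text \<open>The proper part of a Boolean lattice of rank \<open>r\<close> is a sphere of dimension
  \<open>r - 2\<close>. For \<open>i\<close> in \<open>S\<close> but not in \<open>T\<close>, all
  members other than that of \<open>insert i T\<close> form an acyclic poset, and the link of the
  remaining one is the interval above it.\<close>

lemma acyclic_below_coset_interval:
  assumes S: "S \<subseteq> {..<m}" and T: "T \<subset> S" and g: "g \<in> carrier G"
  shows "acyclic_below (int (card S) - int (card T) - 2) (coset_interval T S g)"
  using T
proof (induction "card (S - T)" arbitrary: T rule: less_induct)
  case less
  note T = less.prems
  have finS: "finite S" using S finite_subset by blast
  have le: "coset U g \<le> coset V g \<longleftrightarrow> U \<subseteq> V" and lt: "coset U g < coset V g \<longleftrightarrow> U \<subset> V"
    and eq: "coset U g = coset V g \<longleftrightarrow> U = V"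
    if "U \<subseteq> S" "V \<subseteq> S" for U V
    using coset_le_iff [of U V g g] coset_less_iff [of U V g g] coset_eq_iff [of U V g g]
      that S g near_refl by auto
  obtain i where i: "i \<in> S" "i \<notin> T" using T by auto
  let ?M = "S - {i}" and ?T = "insert i T"
  show ?case
  proof (cases "?T = S")
    case True
    then have "card S = Suc (card T)" using i finS by (metis card_insert_disjoint finite_insert)
    then show ?thesis using acyclic_below_minus_one by simp
  next
    case False
    then have TS: "?T \<subset> S" using T i by auto
    \<comment> \<open>\<open>R\<close> is a cone with apex \<open>coset ?M g\<close>;
      \<open>Q\<close> collects the index sets with \<open>i\<close> other than
      \<open>?T\<close>.\<close>
    define R where "R = {coset U g | U. T \<subset> U \<and> U \<subseteq> ?M}"
    define Q where "Q = {coset U g | U. ?T \<subset> U \<and> U \<subset> S}"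
    define n where "n = int (card S) - int (card T) - 2"
    have R: "acyclic_below n R"
    proof (rule acyclic_below_apex)
      show "coset ?M g \<in> R" unfolding R_def using TS i by blast
      fix r assume "r \<in> R"
      then show "r \<le> coset ?M g \<or> coset ?M g \<le> r"
        using le [of _ ?M] unfolding R_def by blast
    qed
    have finQ: "finite Q"
      using finite_coset_interval [OF S, of ?T g] by (simp add: Q_def coset_interval_def)
    have RQ: "acyclic_below n (R \<union> Q)"
    proof (rule acyclic_below_union_desc [OF finQ _ R])
      show "R \<inter> Q = {}"
      proof -
        have False if "T \<subset> U" "U \<subseteq> ?M" "?T \<subset> V" "V \<subset> S" "coset U g = coset V g" for U V
          using that eq [of U V] by blast
        then show ?thesis unfolding R_def Q_def by blast
      qed
      fix q assume "q \<in> Q"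
      then obtain U where U: "?T \<subset> U" "U \<subset> S" and q: "q = coset U g"
        by (auto simp: Q_def)
      \<comment> \<open>Removing \<open>i\<close> gives the largest element of \<open>R\<close>
        below \<open>q\<close>. It also lies below the larger elements of \<open>Q\<close>, so the
        link is a cone.\<close>
      let ?c = "coset (U - {i}) g"
      have "?c \<in> R" unfolding R_def using U i by blast
      moreover have U': "U - {i} \<subset> U" "U - {i} \<subseteq> S" "U \<subseteq> S" using U by auto
      have cq: "?c < q" unfolding q using lt [OF U'(2,3)] U'(1) by simp
      ultimately have "?c \<in> link R q" by (simp add: link_def)
      moreover have "r \<le> ?c" if "r \<in> link R q" for r
      proof -
        have r1: "r \<in> R" "r < q \<or> q < r" using that by (simp_all add: link_def)
        obtain V where V: "T \<subset> V" "V \<subseteq> ?M" and r: "r = coset V g"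
          using r1(1) unfolding R_def by auto
        have VS: "V \<subseteq> S" using V by auto
        then have "V \<subset> U \<or> U \<subset> V"
          using r1(2) U'(3) unfolding q r by (simp only: lt)
        then have "V \<subseteq> U - {i}" using U V by auto
        then show ?thesis unfolding r using le [OF VS U'(2)] by simp
      qed
      ultimately show "\<exists>c\<in>link R q \<union> {p\<in>Q. q < p}. \<forall>r\<in>link R q \<union> {p\<in>Q. q < p}. r \<le> c \<or> c \<le> r"
        using cq by (intro bexI [of _ ?c]) auto
    qed
    have link: "link (R \<union> Q) (coset ?T g) = coset_interval ?T S g"
    proof (intro equalityI subsetI)
      fix r assume "r \<in> link (R \<union> Q) (coset ?T g)"
      then have r: "r \<in> R \<union> Q" "r < coset ?T g \<or> coset ?T g < r" by (auto simp: link_def)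
      show "r \<in> coset_interval ?T S g"
      proof (cases "r \<in> Q")
        case True
        then show ?thesis by (simp add: Q_def coset_interval_def)
      next
        case False
        then obtain U where U: "T \<subset> U" "U \<subseteq> ?M" "r = coset U g" using r by (auto simp: R_def)
        then have "U \<subset> ?T \<or> ?T \<subset> U" using r(2) lt [of U ?T] lt [of ?T U] TS by auto
        then show ?thesis using U by blast
      qed
    next
      fix r assume "r \<in> coset_interval ?T S g"
      then obtain U where U: "?T \<subset> U" "U \<subset> S" "r = coset U g"
        by (auto simp: coset_interval_def)
      then have "coset ?T g < r" using lt [of ?T U] by auto
      then show "r \<in> link (R \<union> Q) (coset ?T g)"
        using U by (auto simp: link_def Q_def)
    qed
    have "card (S - ?T) < card (S - T)"
      by (rule psubset_card_mono) (use finS i in auto)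
    then have "acyclic_below (int (card S) - int (card ?T) - 2) (coset_interval ?T S g)"
      using less.hyps TS by blast
    moreover have "finite T" using T finS by (meson finite_subset psubset_imp_subset)
    ultimately have "acyclic_below (n - 1) (link (R \<union> Q) (coset ?T g))"
      using i(2) by (simp add: link n_def algebra_simps)
    moreover have "coset ?T g \<notin> R \<union> Q"
    proof
      assume "coset ?T g \<in> R \<union> Q"
      then obtain U where "coset ?T g = coset U g" "U \<subseteq> ?M \<or> ?T \<subset> U \<and> U \<subset> S"
        unfolding R_def Q_def by auto
      then show False using eq [of ?T U] TS by auto
    qed
    ultimately have "acyclic_below n (insert (coset ?T g) (R \<union> Q))"
      using RQ by (intro acyclic_below_insert) auto
    also have "insert (coset ?T g) (R \<union> Q) = coset_interval T S g"
    proof (intro equalityI subsetI)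
      fix r assume "r \<in> insert (coset ?T g) (R \<union> Q)"
      then consider "r = coset ?T g" | "r \<in> R" | "r \<in> Q" by blast
      then show "r \<in> coset_interval T S g"
      proof cases
        case 1
        have "T \<subset> ?T" using i by auto
        then show ?thesis using 1 TS unfolding coset_interval_def by auto
      next
        case 2
        then obtain U where U: "r = coset U g" "T \<subset> U" "U \<subseteq> ?M"
          unfolding R_def by auto
        then have "U \<subset> S" using i by auto
        then show ?thesis using U unfolding coset_interval_def by auto
      next
        case 3
        then obtain U where U: "r = coset U g" "?T \<subset> U" "U \<subset> S"
          unfolding Q_def by auto
        then have "T \<subset> U" by auto
        then show ?thesis using U unfolding coset_interval_def by auto
      qed
    next
      fix r assume "r \<in> coset_interval T S g"
      then obtain U where U: "T \<subset> U" "U \<subset> S" "r = coset U g"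
        by (auto simp: coset_interval_def)
      show "r \<in> insert (coset ?T g) (R \<union> Q)"
      proof (cases "i \<in> U")
        case True
        then have "U = ?T \<or> ?T \<subset> U" using U by auto
        then show ?thesis using U by (auto simp: Q_def)
      next
        case False
        then show ?thesis using U unfolding R_def by blast
      qed
    qed
    finally show ?thesis by (simp add: n_def)
  qed
qed

text \<open>Equivalently, \<open>e S = e {i} <#> e (S - {i})\<close>.\<close>

definition splits :: "nat set \<Rightarrow> nat \<Rightarrow> bool" where
  "splits S i \<longleftrightarrow> i \<in> S \<and> (\<forall>x y. near S x y \<longrightarrow> (\<exists>z. near {i} x z \<and> near (S - {i}) z y))"

section \<open>The cosets below \<open>coset S g\<close>, assembled along a splitting\<close>

context
  fixes S :: "nat set" and i :: nat and g :: 'a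
  assumes S: "S \<subseteq> {..<m}" and splits: "splits S i" and g: "g \<in> carrier G"
begin

private abbreviation "M \<equiv> S - {i}"
private abbreviation "n \<equiv> int (card S) - 1"

text \<open>The closed lower part: \<open>coset M x\<close> together with all cosets inside
  it.\<close>

private definition "Low x = {coset T y | T y. T \<subseteq> M \<and> near M y x}"
text \<open>Together with the sets \<open>Low x\<close> for \<open>x\<close> in
  \<open>coset S g\<close>, this exhausts \<open>cosets_below S g\<close>, since an index set
  without \<open>i\<close> is contained in \<open>M\<close>.\<close>

private definition "Up = {coset T y | T y. i \<in> T \<and> T \<subset> S \<and> near S y g}"

private lemma M: "M \<subseteq> {..<m}" and iS: "i \<in> S"
  using S splits by (auto simp: splits_def)

private lemma less_iff: "near S x g \<Longrightarrow> near S y g \<Longrightarrow> T \<subseteq> S \<Longrightarrow> U \<subseteq> S \<Longrightarrow>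
    coset T x < coset U y \<longleftrightarrow> T \<subset> U \<and> near U x y"
  and le_iff: "near S x g \<Longrightarrow> near S y g \<Longrightarrow> T \<subseteq> S \<Longrightarrow> U \<subseteq> S \<Longrightarrow>
    coset T x \<le> coset U y \<longleftrightarrow> T \<subseteq> U \<and> near U x y"
  and eq_iff: "near S x g \<Longrightarrow> near S y g \<Longrightarrow> T \<subseteq> S \<Longrightarrow> U \<subseteq> S \<Longrightarrow>
    coset T x = coset U y \<longleftrightarrow> T = U \<and> near U x y"
  using coset_less_iff [of T U x y] coset_le_iff [of T U x y] coset_eq_iff [of T U x y] S
    near_carrier(1) by blast+

private lemma near_M_S: "near M y x \<Longrightarrow> near S x g \<Longrightarrow> near S y g"
  using near_mono [of M S] near_trans [OF S] S by blast

private lemma Low_E: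
  assumes "r \<in> Low x" "near S x g"
  obtains T y where "r = coset T y" "T \<subseteq> M" "near M y x" "near S y g"
  using assms near_M_S unfolding Low_def by blast

private lemma Up_E:
  assumes "r \<in> Up"
  obtains T y where "r = coset T y" "i \<in> T" "T \<subset> S" "near S y g"
  using assms unfolding Up_def by blast

private lemma Low_Up_disjoint:
  assumes "near S x g"
  shows "Low x \<inter> Up = {}"
proof -
  have False if rx: "r \<in> Low x" "r \<in> Up" for r
  proof -
    obtain T y where 1: "r = coset T y" "T \<subseteq> M" "near M y x" "near S y g"
      using Low_E [OF rx(1) assms] .
    obtain T' y' where 2: "r = coset T' y'" "i \<in> T'" "T' \<subset> S" "near S y' g"
      using Up_E [OF rx(2)] .
    have "T = T'" using eq_iff [OF 1(4) 2(4), of T T'] 1 2 by auto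
    then show False using 1 2 by auto
  qed
  then show ?thesis by auto
qed

private lemma Low_cong:
  assumes "near M x y"
  shows "Low x = Low y"
  unfolding Low_def using near_trans [OF M] near_sym [OF M] assms by blast

private lemma Low_eq:
  assumes x: "near S x g"
  shows "Low x = insert (coset M x) (cosets_below M x)"
proof (intro equalityI subsetI)
  fix r assume "r \<in> Low x"
  then obtain T y where r: "r = coset T y" "T \<subseteq> M" "near M y x" "near S y g"
    using Low_E [OF _ x] by metis
  show "r \<in> insert (coset M x) (cosets_below M x)"
  proof (cases "T = M")
    case True
    then show ?thesis using r eq_iff [of y x M M] x by blast
  next
    case False
    then show ?thesis using r unfolding cosets_below_def by blast
  qed
next
  fix r assume "r \<in> insert (coset M x) (cosets_below M x)"
  then show "r \<in> Low x"
    using near_refl [OF M near_carrier(1) [OF x]] unfolding cosets_below_def Low_def by blast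
qed

text \<open>\<open>Low g\<close> is a cone with apex \<open>coset M g\<close>. By the splitting
  every \<open>coset T y\<close> in \<open>Up\<close> meets \<open>coset M g\<close>, say in
  \<open>z\<close>; the intersection \<open>coset (T - {i}) z\<close> is the apex of the link at the
  time of insertion.\<close>

private lemma acyclic_below_Low_Up: "acyclic_below k (Low g \<union> Up)"
proof (rule acyclic_below_union_desc)
  have gg: "near S g g" by (rule near_refl [OF S g])
  show "finite Up"
  proof (rule finite_subset [OF _ finite_cosets])
    show "Up \<subseteq> {coset T x | T x. T \<subseteq> {..<m} \<and> x \<in> carrier G}"
      unfolding Up_def using near_carrier(1) S by blast
  qed
  show "Low g \<inter> Up = {}" by (rule Low_Up_disjoint [OF gg])
  show "acyclic_below k (Low g)"
  proof (rule acyclic_below_apex)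
    show "coset M g \<in> Low g" by (simp add: Low_eq [OF gg])
    fix r assume "r \<in> Low g"
    then obtain T y where "r = coset T y" "T \<subseteq> M" "near M y g" "near S y g"
      using Low_E [OF _ gg] by metis
    then show "r \<le> coset M g \<or> coset M g \<le> r"
      using le_iff [of y g T M] gg by auto
  qed
  fix q assume "q \<in> Up"
  then obtain T y where q: "q = coset T y" "i \<in> T" "T \<subset> S" "near S y g"
    using Up_E by metis
  have T: "T \<subseteq> {..<m}" using q S by auto
  obtain z where z: "near {i} y z" "near M z g"
    using splits q(4) unfolding splits_def by blast
  have zS: "near S z g" by (rule near_M_S [OF z(2) gg])
  have yz: "near T y z" by (rule near_mono [OF _ T z(1)]) (use q in auto)
  let ?c = "coset (T - {i}) z"
  have c: "?c \<in> Low g" unfolding Low_def using z(2) q by blast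
  have cq: "?c < q"
    unfolding q using less_iff [OF zS q(4), of "T - {i}" T] q near_sym [OF T yz] by auto
  have le: "r \<le> ?c" if "r \<in> link (Low g) q" for r
  proof -
    have r1: "r \<in> Low g" "r < q \<or> q < r" using that by (auto simp: link_def)
    then obtain U x where r: "r = coset U x" "U \<subseteq> M" "near M x g" "near S x g"
      using Low_E [OF _ gg] by metis
    have U: "U \<subseteq> S" "i \<notin> U" using r by auto
    have "U \<subset> T \<and> near T x y \<or> T \<subset> U"
      using r1(2) less_iff [OF r(4) q(4) U(1)] less_iff [OF q(4) r(4) _ U(1)] q r(1) by auto
    then have UT: "U \<subseteq> T - {i}" and "near T x y" using U q by auto
    then have "near T x z" using near_trans [OF T _ yz] by blast
    moreover have "near M x z" using near_trans [OF M r(3)] near_sym [OF M z(2)] by blast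
    ultimately have "near (T \<inter> M) x z" by (rule near_Int [OF T M])
    moreover have "T \<inter> M = T - {i}" using q by auto
    ultimately show ?thesis
      unfolding r(1) using le_iff [OF r(4) zS U(1), of "T - {i}"] q UT by auto
  qed
  show "\<exists>c\<in>link (Low g) q \<union> {p\<in>Up. q < p}.
      \<forall>r\<in>link (Low g) q \<union> {p\<in>Up. q < p}. r \<le> c \<or> c \<le> r"
  proof (intro bexI ballI)
    show "?c \<in> link (Low g) q \<union> {p\<in>Up. q < p}"
      using c cq by (simp add: link_def)
    fix r assume "r \<in> link (Low g) q \<union> {p\<in>Up. q < p}"
    then show "r \<le> ?c \<or> ?c \<le> r"
      using le cq by auto
  qed
qed

text \<open>The stage of the construction reached when the cosets inside \<open>coset M x\<close>
  have been added for all \<open>x \<in> X\<close>.\<close>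

private definition "Part X = Up \<union> (\<Union>x\<in>X. Low x)"

text \<open>First the cosets strictly inside \<open>coset M x\<close> enter along cones, then
  \<open>coset M x\<close> itself, whose link is \<open>cosets_below M x\<close>. This last
  insertion supplies the cycle.\<close>

private lemma Part_step:
  assumes X: "\<And>y. y \<in> X \<Longrightarrow> near S y g" and x: "near S x g"
    and new: "\<And>y. y \<in> X \<Longrightarrow> \<not> near M x y" and P: "acyclic_below n (Part X)"
    and D: "acyclic_below (n - 1) (cosets_below M x)" "has_cycle (n - 1) (cosets_below M x)"
  shows "acyclic_below n (Part (insert x X)) \<and> has_cycle n (Part (insert x X))"
proof -
  have xc: "x \<in> carrier G" using x by (rule near_carrier)
  have D_E: "\<exists>T y. q = coset T y \<and> T \<subset> M \<and> near M y x \<and> near S y g" if "q \<in> cosets_below M x" for q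
    using that near_M_S x unfolding cosets_below_def by blast
  \<comment> \<open>Different cosets of \<open>e M\<close> are disjoint, so a coset inside one is
    not comparable to a coset inside the other.\<close>
  have apart: "\<not> r < q \<and> \<not> q < r \<and> r \<noteq> q" if "r \<in> (\<Union>y\<in>X. Low y)" "q \<in> Low x" for r q
  proof -
    obtain x' where x': "x' \<in> X" "r \<in> Low x'" using \<open>r \<in> (\<Union>y\<in>X. Low y)\<close> by auto
    obtain U z where r: "r = coset U z" "U \<subseteq> M" "near M z x'" "near S z g"
      using Low_E [OF x'(2) X [OF x'(1)]] .
    obtain T y where q: "q = coset T y" "T \<subseteq> M" "near M y x" "near S y g"
      using Low_E [OF \<open>q \<in> Low x\<close> x] .
    have *: "\<not> near M y z"
      using new [OF x'(1)] near_trans [OF M] near_sym [OF M] q(3) r(3) by blast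
    have 1: "\<not> near U y z" using * near_mono [OF r(2) M] by blast
    have 2: "\<not> near T z y" using * near_mono [OF q(2) M] near_sym [OF M] by blast
    have "U \<subseteq> S" "T \<subseteq> S" using r q by auto
    then show ?thesis
      unfolding r(1) q(1) using 1 2 less_iff [OF r(4) q(4)] less_iff [OF q(4) r(4)]
        eq_iff [OF r(4) q(4)] by auto
  qed
  have Dlow: "cosets_below M x \<subseteq> Low x" and Mlow: "coset M x \<in> Low x"
    unfolding Low_eq [OF x] by auto
  have PD: "acyclic_below n (Part X \<union> cosets_below M x)"
  proof (rule acyclic_below_union_asc [OF finite_cosets_below [OF M] _ P])
    show "Part X \<inter> cosets_below M x = {}"
      using apart Dlow Low_Up_disjoint [OF x] unfolding Part_def by blast
    fix q assume qD: "q \<in> cosets_below M x"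
    then obtain T y where q: "q = coset T y" "T \<subset> M" "near M y x" "near S y g"
      using D_E [OF qD] by auto
    have T: "insert i T \<subset> S" "i \<notin> T" "T \<subseteq> S" using q iS by auto
    \<comment> \<open>The smallest element of \<open>Up\<close> above \<open>q\<close>, and hence
      above the smaller cosets that entered before. Its index set is proper in \<open>S\<close>
      because \<open>T\<close> is proper in \<open>M\<close>.\<close>
    let ?c = "coset (insert i T) y"
    have yy: "near (insert i T) y y"
      by (rule near_refl) (use T S near_carrier(1) [OF q(4)] in auto)
    have c: "?c \<in> Up" unfolding Up_def using T q(4) by blast
    have qc: "q < ?c"
      unfolding q(1) using less_iff [OF q(4) q(4), of T "insert i T"] T yy by auto
    have le: "?c \<le> r" if "r \<in> link (Part X) q" for r
    proof -
      have r1: "r \<in> Part X" "r < q \<or> q < r" using that by (auto simp: link_def)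
      then have "r \<in> Up" using apart qD Dlow unfolding Part_def by blast
      then obtain U z where r: "r = coset U z" "i \<in> U" "U \<subset> S" "near S z g"
        using Up_E by metis
      have "\<not> U \<subset> T" using r T by auto
      then have "T \<subset> U" "near U y z"
        using r1(2) less_iff [OF r(4) q(4), of U T] less_iff [OF q(4) r(4), of T U] r q(1) T by auto
      then show ?thesis
        unfolding r(1) using le_iff [OF q(4) r(4), of "insert i T" U] r T by auto
    qed
    show "\<exists>c\<in>link (Part X) q \<union> {p\<in>cosets_below M x. p < q}.
        \<forall>r\<in>link (Part X) q \<union> {p\<in>cosets_below M x. p < q}. r \<le> c \<or> c \<le> r"
    proof (intro bexI ballI)
      show "?c \<in> link (Part X) q \<union> {p\<in>cosets_below M x. p < q}"
        using c qc by (simp add: link_def Part_def)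
      fix r assume "r \<in> link (Part X) q \<union> {p\<in>cosets_below M x. p < q}"
      then show "r \<le> ?c \<or> ?c \<le> r"
        using le qc by auto
    qed
  qed
  have link: "link (Part X \<union> cosets_below M x) (coset M x) = cosets_below M x"
  proof (intro equalityI subsetI)
    fix r assume "r \<in> link (Part X \<union> cosets_below M x) (coset M x)"
    then have r1: "r \<in> Part X \<union> cosets_below M x" "r < coset M x \<or> coset M x < r"
      by (auto simp: link_def)
    \<comment> \<open>The index set of a member of \<open>Up\<close> contains \<open>i\<close> and
      differs from \<open>S\<close>, so it is not comparable to \<open>M\<close>.\<close>
    have "r \<notin> Up"
    proof
      assume "r \<in> Up"
      then obtain U z where r: "r = coset U z" "i \<in> U" "U \<subset> S" "near S z g"
        using Up_E by metis
      then have "\<not> U \<subset> M" "\<not> M \<subset> U" by auto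
      then show False
        using r1(2) less_iff [OF r(4) x, of U M] less_iff [OF x r(4), of M U] r by auto
    qed
    then show "r \<in> cosets_below M x"
      using r1 apart Mlow unfolding Part_def by blast
  next
    fix r assume r: "r \<in> cosets_below M x"
    moreover obtain T y where "r = coset T y" "T \<subset> M" "near M y x" "near S y g"
      using D_E [OF r] by auto
    then have "r < coset M x" using less_iff [of y x T M] x by auto
    ultimately show "r \<in> link (Part X \<union> cosets_below M x) (coset M x)"
      by (simp add: link_def)
  qed
  have notin: "coset M x \<notin> Part X \<union> cosets_below M x"
  proof -
    have "coset M x \<notin> cosets_below M x" using link not_mem_link by metis
    then show ?thesis
      using apart Mlow Low_Up_disjoint [OF x] unfolding Part_def by blast
  qed
  have "Part (insert x X) = insert (coset M x) (Part X \<union> cosets_below M x)"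
    unfolding Part_def using Low_eq [OF x] by auto
  then show ?thesis
    using acyclic_below_insert [OF PD notin] has_cycle_insert [OF PD notin] D by (simp add: link)
qed

text \<open>Starting from \<open>Low g \<union> Up\<close>, the cosets of \<open>e M\<close> inside
  \<open>coset S g\<close> are added one after the other.\<close>

lemma splitting_step:
  assumes D: "\<And>x. x \<in> carrier G \<Longrightarrow> acyclic_below (n - 1) (cosets_below M x) \<and>
    has_cycle (n - 1) (cosets_below M x)"
  shows "acyclic_below n (cosets_below S g) \<and> has_cycle n (cosets_below S g)"
proof -
  have gg: "near S g g" by (rule near_refl [OF S g])
  have Pg: "acyclic_below n (Part {g})"
    using acyclic_below_Low_Up by (simp add: Part_def Un_commute)
  have P: "acyclic_below n (Part (insert g X))"
    if "finite X" "X \<subseteq> {x. near S x g}" for X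
    using that
  proof (induction X)
    case empty
    then show ?case using Pg by simp
  next
    case (insert x X)
    then have IH: "acyclic_below n (Part (insert g X))" by auto
    have x: "near S x g" using insert.prems by simp
    show ?case
    proof (cases "\<exists>y\<in>insert g X. near M x y")
      case True
      then obtain y where "y \<in> insert g X" "Low x = Low y" using Low_cong by blast
      then have "Part (insert g (insert x X)) = Part (insert g X)"
        unfolding Part_def by auto
      then show ?thesis using IH by simp
    next
      case False
      have "acyclic_below n (Part (insert x (insert g X)))"
        using Part_step [of "insert g X" x] insert.prems gg False IH D [OF near_carrier(1) [OF x]]
        by blast
      then show ?thesis by (simp add: insert_commute)
    qed
  qed
  have sub: "Part X \<subseteq> cosets_below S g" if X: "X \<subseteq> {x. near S x g}" for X
  proof
    fix r assume "r \<in> Part X"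
    then consider "r \<in> Up" | x where "x \<in> X" "r \<in> Low x" by (auto simp: Part_def)
    then show "r \<in> cosets_below S g"
    proof cases
      case 1
      then show ?thesis using Up_E unfolding cosets_below_def by blast
    next
      case 2
      then obtain T y where "r = coset T y" "T \<subseteq> M" "near S y g" using Low_E [of r x] X by blast
      then show ?thesis using iS unfolding cosets_below_def by blast
    qed
  qed
  have "Part (insert g {x. near S x g}) = cosets_below S g"
  proof
    show "Part (insert g {x. near S x g}) \<subseteq> cosets_below S g" by (rule sub) (use gg in auto)
    show "cosets_below S g \<subseteq> Part (insert g {x. near S x g})"
    proof
      fix r assume "r \<in> cosets_below S g"
      then obtain T y where r: "r = coset T y" "T \<subset> S" "near S y g" by (auto simp: cosets_below_def)
      show "r \<in> Part (insert g {x. near S x g})"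
      proof (cases "i \<in> T")
        case True
        then show ?thesis using r unfolding Part_def Up_def by blast
      next
        case False
        then have "r \<in> Low y"
          using r near_refl [OF M near_carrier(1) [OF r(3)]] unfolding Low_def by blast
        then show ?thesis using r unfolding Part_def by blast
      qed
    qed
  qed
  moreover have "finite {x. near S x g}"
    by (rule finite_subset [OF _ fin]) (auto simp: near_def)
  ultimately have ac: "acyclic_below n (cosets_below S g)"
    using P [of "{x. near S x g}"] by simp
  \<comment> \<open>For the cycle a single further coset of \<open>e M\<close> suffices, since a
    nonzero cycle survives in larger posets. It exists because \<open>e M\<close> is a proper
    subgroup of \<open>e S\<close>.\<close>
  obtain y where y: "near S y g" "\<not> near M y g"
    using ex_near_not_near [OF S _ g, of M] iS by blast
  have "has_cycle n (Part (insert y {g}))"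
    using Part_step [of "{g}" y] y gg Pg D [OF near_carrier(1) [OF y(1)]] by blast
  then have "has_cycle n (cosets_below S g)"
    by (rule has_cycle_mono) (rule sub, use y gg in auto)
  with ac show ?thesis by blast
qed

end

end


section \<open>Counting in finite groups\<close>

context group
begin

text \<open>\<open>W\<close> is a union of left cosets of \<open>L\<close>, so if it misses
  \<open>k\<close>, it misses the whole left coset of \<open>k\<close>.\<close>

lemma card_add_le_card:
  assumes fin: "finite K" and L: "subgroup L G" and K: "subgroup K G" and LK: "L \<subseteq> K"
    and W: "W \<subseteq> K" "\<And>w l. w \<in> W \<Longrightarrow> l \<in> L \<Longrightarrow> w \<otimes> l \<in> W" and k: "k \<in> K" "k \<notin> W"
  shows "card W + card L \<le> card K"
proof -
  have Lc: "L \<subseteq> carrier G" and Kc: "K \<subseteq> carrier G"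
    using L K by (auto dest: subgroup.subset)
  have kc: "k \<in> carrier G" using k Kc by auto
  have "inj_on ((\<otimes>) k) L"
    by (rule inj_onI) (use kc Lc in \<open>auto simp: subset_iff\<close>)
  then have "card L = card ((\<otimes>) k ` L)" by (simp add: card_image)
  moreover have "W \<inter> (\<otimes>) k ` L = {}"
  proof -
    have False if l: "l \<in> L" and kl: "k \<otimes> l \<in> W" for l
    proof -
      have "k \<otimes> l \<otimes> inv l \<in> W"
        using W(2) [OF kl] subgroup.m_inv_closed [OF L l] by auto
      moreover have "k \<otimes> l \<otimes> inv l = k" using kc l Lc by (auto simp: m_assoc)
      ultimately show False using k by simp
    qed
    then show ?thesis by auto
  qed
  moreover have "(\<otimes>) k ` L \<subseteq> K" using subgroup.m_closed [OF K k(1)] LK by auto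
  ultimately have "card W + card L = card (W \<union> (\<otimes>) k ` L)" "W \<union> (\<otimes>) k ` L \<subseteq> K"
    using W(1) fin by (auto intro!: card_Un_disjoint [symmetric] intro: finite_subset)
  then show ?thesis using fin card_mono by metis
qed

text \<open>A subgroup of index at most 2 is normal: if the conjugate of \<open>h\<close> by
  \<open>a\<close> leaves \<open>H\<close>, then \<open>H\<close>, the left coset of
  \<open>a\<close> and the left coset of that conjugate are distinct.\<close>

lemma conjugation_closed_or_index_ge_3:
  assumes fin: "finite A" and H: "subgroup H G" and A: "subgroup A G" and HA: "H \<subseteq> A"
  shows "(\<forall>a\<in>A. \<forall>h\<in>H. a \<otimes> h \<otimes> inv a \<in> H) \<or> 3 * card H \<le> card A"
proof (rule disjCI)
  assume small: "\<not> 3 * card H \<le> card A"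
  have Ac: "A \<subseteq> carrier G" using A by (rule subgroup.subset)
  show "\<forall>a\<in>A. \<forall>h\<in>H. a \<otimes> h \<otimes> inv a \<in> H"
  proof (intro ballI)
    fix a h assume a: "a \<in> A" and h: "h \<in> H"
    have c: "a \<in> carrier G" "h \<in> carrier G" using a h Ac HA by auto
    show "a \<otimes> h \<otimes> inv a \<in> H"
    proof (rule ccontr)
      assume x: "a \<otimes> h \<otimes> inv a \<notin> H"
      then have aH: "a \<notin> H"
        using h subgroup.m_closed [OF H] subgroup.m_inv_closed [OF H] by auto
      define W where "W = H \<union> (\<otimes>) a ` H"
      have "card H + card H \<le> card W"
      proof -
        have "inj_on ((\<otimes>) a) H"
          by (rule inj_onI) (use c HA Ac in \<open>auto simp: subset_iff\<close>)
        then have "card ((\<otimes>) a ` H) = card H" by (rule card_image)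
        moreover have "H \<inter> (\<otimes>) a ` H = {}"
        proof -
          have False if l: "l \<in> H" and kl: "a \<otimes> l \<in> H" for l
          proof -
            have "a \<otimes> l \<otimes> inv l \<in> H"
              using subgroup.m_closed [OF H kl] subgroup.m_inv_closed [OF H l] by auto
            moreover have "a \<otimes> l \<otimes> inv l = a" using c l HA Ac by (auto simp: m_assoc)
            ultimately show False using aH by simp
          qed
          then show ?thesis by auto
        qed
        moreover have "finite H" using HA fin by (rule finite_subset)
        ultimately show ?thesis by (simp add: W_def card_Un_disjoint)
      qed
      moreover have "card W + card H \<le> card A"
      proof (rule card_add_le_card [OF fin H A HA])
        show "W \<subseteq> A" unfolding W_def using HA subgroup.m_closed [OF A a] by auto
        fix w l assume "w \<in> W" "l \<in> H"
        then show "w \<otimes> l \<in> W"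
          unfolding W_def using subgroup.m_closed [OF H] c HA Ac by (auto simp: m_assoc subset_iff)
      next
        show "a \<otimes> h \<otimes> inv a \<in> A"
          using a h HA subgroup.m_closed [OF A] subgroup.m_inv_closed [OF A] by auto
        \<comment> \<open>The equation would force \<open>a = inv l \<otimes> h\<close>, an element
          of \<open>H\<close>.\<close>
        have False if l: "l \<in> H" and eq: "a \<otimes> h \<otimes> inv a = a \<otimes> l" for l
        proof -
          have lc: "l \<in> carrier G" using l HA Ac by auto
          then have "h \<otimes> inv a = l" using eq c by (simp add: m_assoc)
          then have "inv l \<otimes> h = a"
            using c lc by (metis inv_closed inv_inv inv_mult_group inv_solve_right m_assoc m_closed r_inv r_one)
          then show False
            using aH h subgroup.m_closed [OF H subgroup.m_inv_closed [OF H l] h] by simp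
        qed
        then show "a \<otimes> h \<otimes> inv a \<notin> W" using x by (auto simp: W_def)
      qed
      ultimately show False using small by simp
    qed
  qed
qed

text \<open>The fibre of the multiplication map over \<open>a \<otimes> b\<close> embeds into
  \<open>A \<inter> B\<close> by sending \<open>(x, y)\<close> to \<open>inv a \<otimes> x\<close>,
  which also equals \<open>b \<otimes> inv y\<close>.\<close>

lemma card_set_mult_ge:
  assumes A: "subgroup A G" and B: "subgroup B G" and fin: "finite A" "finite B"
  shows "card A * card B \<le> card (A <#> B) * card (A \<inter> B)"
proof -
  define f where "f = (\<lambda>(a, b). a \<otimes> b)"
  have Ac: "A \<subseteq> carrier G" and Bc: "B \<subseteq> carrier G"
    using A B by (auto dest: subgroup.subset)
  have im: "f ` (A \<times> B) = A <#> B"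
    by (auto simp: f_def set_mult_def)
  have fibre: "card {p \<in> A \<times> B. f p = w} \<le> card (A \<inter> B)" if w: "w \<in> f ` (A \<times> B)" for w
  proof -
    obtain a b where ab: "a \<in> A" "b \<in> B" "w = a \<otimes> b" using w by (auto simp: f_def)
    show ?thesis
    proof (rule card_inj_on_le)
      show "inj_on (\<lambda>p. inv a \<otimes> fst p) {p \<in> A \<times> B. f p = w}"
      proof (rule inj_onI)
        fix p q assume p: "p \<in> {p \<in> A \<times> B. f p = w}" and q: "q \<in> {p \<in> A \<times> B. f p = w}"
          and eq: "inv a \<otimes> fst p = inv a \<otimes> fst q"
        have c: "a \<in> carrier G" "fst p \<in> carrier G" "fst q \<in> carrier G"
          "snd p \<in> carrier G" "snd q \<in> carrier G"
          using p q ab Ac Bc by auto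
        have 1: "fst p = fst q" using eq c by simp
        have "fst p \<otimes> snd p = fst q \<otimes> snd q"
          using p q by (auto simp: f_def split_beta)
        then have "snd p = snd q" using 1 c by simp
        then show "p = q" using 1 by (simp add: prod_eq_iff)
      qed
      show "(\<lambda>p. inv a \<otimes> fst p) ` {p \<in> A \<times> B. f p = w} \<subseteq> A \<inter> B"
      proof -
        have "inv a \<otimes> x \<in> A \<inter> B" if x: "x \<in> A" "y \<in> B" "x \<otimes> y = w" for x y
        proof
          have c: "a \<in> carrier G" "x \<in> carrier G" "b \<in> carrier G" "y \<in> carrier G"
            using x ab Ac Bc by auto
          have "x = a \<otimes> b \<otimes> inv y"
            using c x(3) ab(3) inv_solve_right [of x "a \<otimes> b" y] by simp
          then have "inv a \<otimes> x = b \<otimes> inv y"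
            using c by (simp add: m_assoc [symmetric])
          then show "inv a \<otimes> x \<in> B"
            using ab x subgroup.m_closed [OF B] subgroup.m_inv_closed [OF B] by simp
          show "inv a \<otimes> x \<in> A"
            using ab x subgroup.m_closed [OF A] subgroup.m_inv_closed [OF A] by simp
        qed
        then show ?thesis by (auto simp: f_def)
      qed
      show "finite (A \<inter> B)" using fin by simp
    qed
  qed
  have "card A * card B = card (A \<times> B)" by (simp add: card_cartesian_product)
  also have "\<dots> = (\<Sum>w\<in>f ` (A \<times> B). card {p \<in> A \<times> B. f p = w})"
    using sum.image_gen [of "A \<times> B" "\<lambda>_. 1::nat" f] fin by simp
  also have "\<dots> \<le> (\<Sum>w\<in>f ` (A \<times> B). card (A \<inter> B))"
    by (rule sum_mono) (rule fibre)
  finally show ?thesis by (simp add: im)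
qed

end


section \<open>Splittings\<close>

context boolean_interval
begin

text \<open>A factorisation \<open>x \<otimes> inv y = a \<otimes> b\<close> gives the intermediate
  point \<open>inv a \<otimes> x\<close>.\<close>

lemma splitsI:
  assumes i: "i \<in> S" and S: "S \<subseteq> {..<m}" and prod: "e S \<subseteq> e {i} <#> e (S - {i})"
  shows "splits S i"
  unfolding splits_def
proof (intro conjI allI impI)
  fix x y assume xy: "near S x y"
  then have c: "x \<in> carrier G" "y \<in> carrier G" by (auto simp: near_def)
  have "x \<otimes> inv y \<in> e {i} <#> e (S - {i})" using xy prod by (auto simp: near_def)
  then obtain a b where ab: "a \<in> e {i}" "b \<in> e (S - {i})" "x \<otimes> inv y = a \<otimes> b"
    by (auto simp: set_mult_def)
  have abc: "a \<in> carrier G" "b \<in> carrier G"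
    using ab e_carrier [of "{i}"] e_carrier [of "S - {i}"] i S by auto
  have "x \<otimes> inv (inv a \<otimes> x) = a"
    using c abc by (simp add: inv_mult_group m_assoc [symmetric])
  moreover have "inv a \<otimes> x \<otimes> inv y = b"
    using c abc ab(3) by (simp add: m_assoc) (simp add: m_assoc [symmetric])
  ultimately show "\<exists>z. near {i} x z \<and> near (S - {i}) z y"
    using ab c abc by (intro exI [of _ "inv a \<otimes> x"]) (simp add: near_def)
qed (rule i)

text \<open>If \<open>A = e {i}\<close> normalises \<open>H\<close>, then it acts on the interval by conjugation and fixes \<open>A\<close>,
  hence it fixes the complement \<open>M = e (S - {i})\<close> too, and \<open>A <#> M\<close> is a subgroup.\<close>

lemma splits_if_conjugation_closed:
  assumes i: "i \<in> S" and S: "S \<subseteq> {..<m}"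
    and conj: "\<And>a h. a \<in> e {i} \<Longrightarrow> h \<in> H \<Longrightarrow> a \<otimes> h \<otimes> inv a \<in> H"
  shows "splits S i"
proof (rule splitsI [OF i S])
  let ?A = "e {i}" and ?M = "e (S - {i})"
  have iS: "{i} \<subseteq> {..<m}" "S - {i} \<subseteq> {..<m}" using i S by auto
  interpret A: subgroup ?A G by (rule e_subgroup [OF iS(1)])
  interpret M: subgroup ?M G by (rule e_subgroup [OF iS(2)])
  interpret K: subgroup "e S" G by (rule e_subgroup [OF S])
  have AS: "?A \<subseteq> e S" and MS: "?M \<subseteq> e S"
    using e_le_iff iS S i by auto
  have AM: "\<not> ?A \<subseteq> ?M" using e_le_iff iS by auto
  have conj_M: "x \<in> ?M" if a: "a \<in> ?A" and x: "x \<in> carrier G" and ax: "a \<otimes> x \<otimes> inv a \<in> ?M" for a x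
  proof -
    \<comment> \<open>The conjugate of \<open>?M\<close> by the inverse of \<open>a\<close>. It
      contains \<open>H\<close>, so it is \<open>e T\<close> for some \<open>T\<close>; it remains
      to see that \<open>T\<close> lies in \<open>S\<close> and misses \<open>i\<close>, whence
      \<open>C \<subseteq> ?M\<close>.\<close>
    define C where "C = {x\<in>carrier G. a \<otimes> x \<otimes> inv a \<in> ?M}"
    have ac: "a \<in> carrier G" using a by simp
    have "subgroup C G"
    proof (rule subgroupI)
      show "C \<noteq> {}" using ac by (auto simp: C_def intro!: exI [of _ \<one>])
      fix x assume x: "x \<in> C"
      have "a \<otimes> inv x \<otimes> inv a = inv (a \<otimes> x \<otimes> inv a)"
        using ac x by (simp add: C_def inv_mult_group m_assoc)
      then show "inv x \<in> C" using x by (simp add: C_def)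
    next
      fix x y assume x: "x \<in> C" and y: "y \<in> C"
      have c: "x \<in> carrier G" "y \<in> carrier G" using x y by (auto simp: C_def)
      have "(a \<otimes> x \<otimes> inv a) \<otimes> (a \<otimes> y \<otimes> inv a) = a \<otimes> x \<otimes> (inv a \<otimes> a) \<otimes> y \<otimes> inv a"
        using ac c by (simp only: m_assoc m_closed inv_closed)
      also have "\<dots> = a \<otimes> (x \<otimes> y) \<otimes> inv a"
        using ac c by (simp add: m_assoc)
      finally show "x \<otimes> y \<in> C"
        using x y M.m_closed [of "a \<otimes> x \<otimes> inv a" "a \<otimes> y \<otimes> inv a"] by (simp add: C_def)
    qed (auto simp: C_def)
    moreover have "H \<subseteq> C"
      using conj [OF a] e_ge [OF iS(2)] subgroup.subset [OF subgroup_H] by (auto simp: C_def)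
    ultimately obtain T where T: "T \<subseteq> {..<m}" "C = e T" by (rule e_surj)
    have "C \<subseteq> e S"
    proof
      fix x assume x: "x \<in> C"
      have xc: "x \<in> carrier G" using x by (simp add: C_def)
      have "a \<in> e S" "a \<otimes> x \<otimes> inv a \<in> e S"
        using x a AS MS by (auto simp: C_def)
      then have "inv a \<otimes> (a \<otimes> x \<otimes> inv a) \<otimes> a \<in> e S"
        by (metis K.m_closed K.m_inv_closed)
      moreover have "inv a \<otimes> (a \<otimes> x \<otimes> inv a) \<otimes> a = x"
      proof -
        have "inv a \<otimes> (a \<otimes> x \<otimes> inv a) \<otimes> a = (inv a \<otimes> a) \<otimes> x \<otimes> (inv a \<otimes> a)"
          using ac xc by (simp only: m_assoc m_closed inv_closed)
        then show ?thesis using ac xc by simp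
      qed
      ultimately show "x \<in> e S" by simp
    qed
    then have "T \<subseteq> S" using T e_le_iff S by auto
    moreover have "i \<notin> T"
    proof
      assume "i \<in> T"
      then have AC: "?A \<subseteq> C" using T e_le_iff [OF iS(1) T(1)] by auto
      have "?A \<subseteq> ?M"
      proof
        fix y assume y: "y \<in> ?A"
        have yc: "y \<in> carrier G" using y by simp
        have "inv a \<otimes> y \<otimes> a \<in> C" using y a AC by auto
        then have "a \<otimes> (inv a \<otimes> y \<otimes> a) \<otimes> inv a \<in> ?M" by (simp add: C_def)
        moreover have "a \<otimes> (inv a \<otimes> y \<otimes> a) \<otimes> inv a = (a \<otimes> inv a) \<otimes> y \<otimes> (a \<otimes> inv a)"
          using ac yc by (simp only: m_assoc m_closed inv_closed)
        ultimately show "y \<in> ?M" using ac yc by simp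
      qed
      then show False using AM by simp
    qed
    ultimately have "C \<subseteq> ?M" using T e_le_iff [OF T(1) iS(2)] by auto
    then show ?thesis using x ax by (auto simp: C_def)
  qed
  have normal: "inv a \<otimes> y \<otimes> a \<in> ?M" if a: "a \<in> ?A" and y: "y \<in> ?M" for a y
  proof (rule conj_M [OF a])
    have c: "a \<in> carrier G" "y \<in> carrier G" using a y by auto
    show "inv a \<otimes> y \<otimes> a \<in> carrier G" using c by simp
    have "a \<otimes> (inv a \<otimes> y \<otimes> a) \<otimes> inv a = (a \<otimes> inv a) \<otimes> y \<otimes> (a \<otimes> inv a)"
      using c by (simp only: m_assoc m_closed inv_closed)
    then show "a \<otimes> (inv a \<otimes> y \<otimes> a) \<otimes> inv a \<in> ?M" using c y by simp
  qed
  have "subgroup (?A <#> ?M) G"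
  proof (rule subgroupI)
    show "?A <#> ?M \<subseteq> carrier G" by (rule set_mult_closed) auto
    show "?A <#> ?M \<noteq> {}" using A.one_closed M.one_closed unfolding set_mult_def by blast
    fix x assume "x \<in> ?A <#> ?M"
    then obtain a y where x: "x = a \<otimes> y" "a \<in> ?A" "y \<in> ?M" by (auto simp: set_mult_def)
    have c: "a \<in> carrier G" "y \<in> carrier G" using x by auto
    have "inv x = inv a \<otimes> (inv (inv a) \<otimes> inv y \<otimes> inv a)"
      using c by (simp add: x(1) inv_mult_group m_assoc [symmetric])
    moreover have "inv (inv a) \<otimes> inv y \<otimes> inv a \<in> ?M"
      using x by (intro normal) auto
    ultimately show "inv x \<in> ?A <#> ?M"
      using x(2) unfolding set_mult_def by blast
  next
    fix x z assume "x \<in> ?A <#> ?M" "z \<in> ?A <#> ?M"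
    then obtain a y b w where x: "x = a \<otimes> y" "a \<in> ?A" "y \<in> ?M" and z: "z = b \<otimes> w" "b \<in> ?A" "w \<in> ?M"
      by (auto simp: set_mult_def)
    have c: "a \<in> carrier G" "y \<in> carrier G" "b \<in> carrier G" "w \<in> carrier G" using x z by auto
    have "(a \<otimes> b) \<otimes> ((inv b \<otimes> y \<otimes> b) \<otimes> w) = a \<otimes> (b \<otimes> inv b) \<otimes> y \<otimes> b \<otimes> w"
      using c by (simp only: m_assoc m_closed inv_closed)
    also have "\<dots> = x \<otimes> z"
      using c by (simp add: x(1) z(1) m_assoc)
    finally have "x \<otimes> z = (a \<otimes> b) \<otimes> ((inv b \<otimes> y \<otimes> b) \<otimes> w)" by simp
    moreover have "(inv b \<otimes> y \<otimes> b) \<otimes> w \<in> ?M" using normal [OF z(2) x(3)] z(3) by simp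
    moreover have "a \<otimes> b \<in> ?A" using x z by simp
    ultimately show "x \<otimes> z \<in> ?A <#> ?M"
      unfolding set_mult_def by blast
  qed
  moreover have A_le: "?A \<subseteq> ?A <#> ?M"
  proof
    fix a assume "a \<in> ?A"
    then have "a = a \<otimes> \<one>" by simp
    then show "a \<in> ?A <#> ?M" using \<open>a \<in> ?A\<close> M.one_closed unfolding set_mult_def by blast
  qed
  moreover have M_le: "?M \<subseteq> ?A <#> ?M"
  proof
    fix y assume "y \<in> ?M"
    then have "y = \<one> \<otimes> y" by simp
    then show "y \<in> ?A <#> ?M" using \<open>y \<in> ?M\<close> A.one_closed unfolding set_mult_def by blast
  qed
  ultimately obtain T where T: "T \<subseteq> {..<m}" "?A <#> ?M = e T"
    using e_surj [of "?A <#> ?M"] e_ge [OF iS(1)] by blast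
  \<comment> \<open>A member of the interval above an atom and its complement contains their join
    \<open>e S\<close>.\<close>
  have "S \<subseteq> T"
    using A_le M_le T e_le_iff [OF iS(1) T(1)] e_le_iff [OF iS(2) T(1)] by auto
  then show "e S \<subseteq> ?A <#> ?M" using T e_le_iff [OF S T(1)] by simp
qed

text \<open>The bound 32 enters here. Without a splitting of the preceding kind, all \<open>e {i}\<close> have index at
  least 3 over \<open>H\<close>, so that \<open>M = e (S - {i})\<close> has index at least 9 and \<open>e {i} <#> M\<close> contains
  three cosets of \<open>M\<close>; a fourth one would force the index 36.\<close>

lemma ex_splits:
  assumes S: "S \<subseteq> {..<m}" and card: "3 \<le> card S" and index: "card (e S) < 32 * card H"
  shows "\<exists>i. splits S i"
proof (rule ccontr)
  assume no: "\<nexists>i. splits S i"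
  have fin_e: "finite (e T)" if "T \<subseteq> {..<m}" for T
    using e_carrier [OF that] fin by (rule finite_subset)
  have H0: "card H > 0"
    using subgroup.finite_imp_card_positive [OF subgroup_H fin] .
  have atom: "3 * card H \<le> card (e {i})" if "i \<in> S" for i
    using conjugation_closed_or_index_ge_3 [OF fin_e subgroup_H e_subgroup e_ge, of "{i}"]
      splits_if_conjugation_closed [OF that S] no that S by auto
  have finS: "finite S" using S by (rule finite_subset) simp
  have "S \<noteq> {}" using card by auto
  then obtain i where i: "i \<in> S" by blast
  \<comment> \<open>Rank at least 3 leaves room for two atoms \<open>j\<close> and \<open>k\<close>
    below the complement of \<open>e {i}\<close>; their product accounts for the factor 9.\<close>
  have "card (S - {i}) \<ge> 2" using card i finS by simp
  then have "S - {i} \<noteq> {}" by (metis card.empty not_numeral_le_zero)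
  then obtain j where j: "j \<in> S - {i}" by blast
  have "card (S - {i} - {j}) \<ge> 1" using card i j finS by simp
  then have "S - {i} - {j} \<noteq> {}" by (metis card.empty not_one_le_zero)
  then obtain k where k: "k \<in> S - {i} - {j}" by blast
  let ?M = "e (S - {i})"
  have sub: "{i} \<subseteq> {..<m}" "{j} \<subseteq> {..<m}" "{k} \<subseteq> {..<m}" "S - {i} \<subseteq> {..<m}"
    using i j k S by auto
  have M: "9 * card H \<le> card ?M"
  proof -
    have "e {j} <#> e {k} \<subseteq> ?M"
      using e_le_iff [OF sub(2,4)] e_le_iff [OF sub(3,4)] j k
        subgroup.m_closed [OF e_subgroup [OF sub(4)]] by (auto simp: set_mult_def)
    then have "card (e {j} <#> e {k}) \<le> card ?M"
      by (intro card_mono fin_e sub)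
    moreover have "{j} \<inter> {k} = {}" using k by auto
    then have "card (e {j}) * card (e {k}) \<le> card (e {j} <#> e {k}) * card H"
      using card_set_mult_ge [OF e_subgroup e_subgroup fin_e fin_e, OF sub(2,3) sub(2,3)]
      by (simp add: e_Int [OF sub(2,3)] e_empty)
    moreover have "(3 * card H) * (3 * card H) \<le> card (e {j}) * card (e {k})"
      using atom [of j] atom [of k] j k by (intro mult_mono) auto
    ultimately have "(3 * card H) * (3 * card H) \<le> card ?M * card H"
      by (meson le_trans mult_le_mono1)
    then have "(9 * card H) * card H \<le> card ?M * card H" by (simp add: algebra_simps)
    then show ?thesis using H0 by simp
  qed
  let ?W = "e {i} <#> ?M"
  have W: "3 * card ?M \<le> card ?W"
  proof -
    have "{i} \<inter> (S - {i}) = {}" by auto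
    then have "card (e {i}) * card ?M \<le> card ?W * card H"
      using card_set_mult_ge [OF e_subgroup e_subgroup fin_e fin_e, OF sub(1,4) sub(1,4)]
      by (simp add: e_Int [OF sub(1,4)] e_empty)
    moreover have "(3 * card H) * card ?M \<le> card (e {i}) * card ?M"
      using atom [OF i] by (rule mult_le_mono1)
    ultimately have "(3 * card H) * card ?M \<le> card ?W * card H"
      by (rule le_trans [rotated])
    then have "(3 * card ?M) * card H \<le> card ?W * card H" by (simp only: mult_ac)
    then show ?thesis using H0 by simp
  qed
  have "\<not> e S \<subseteq> ?W" using splitsI [OF i S] no by auto
  then obtain k where k: "k \<in> e S" "k \<notin> ?W" by auto
  have "card ?W + card ?M \<le> card (e S)"
  proof (rule card_add_le_card [OF fin_e [OF S] e_subgroup [OF sub(4)] e_subgroup [OF S] _ _ _ k])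
    show "?M \<subseteq> e S" using e_le_iff [OF sub(4) S] by auto
    then show "?W \<subseteq> e S"
      using e_le_iff [OF sub(1) S] i subgroup.m_closed [OF e_subgroup [OF S]]
      by (auto simp: set_mult_def)
    fix w l assume "w \<in> ?W" "l \<in> ?M"
    then obtain a y where w: "w = a \<otimes> y" "a \<in> e {i}" "y \<in> ?M" by (auto simp: set_mult_def)
    have "w \<otimes> l = a \<otimes> (y \<otimes> l)"
      using w \<open>l \<in> ?M\<close> e_carrier [OF sub(1)] e_carrier [OF sub(4)] by (auto simp: m_assoc subset_iff)
    moreover have "y \<otimes> l \<in> ?M"
      using w \<open>l \<in> ?M\<close> subgroup.m_closed [OF e_subgroup [OF sub(4)]] by simp
    ultimately show "w \<otimes> l \<in> ?W" using w unfolding set_mult_def by blast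
  qed
  then show False using W M index by simp
qed

text \<open>The complement of the atom is \<open>H\<close>, and \<open>z = y\<close> works.\<close>

lemma splits_singleton:
  assumes "i < m"
  shows "splits {i} i"
  unfolding splits_def using near_refl [of "{}"] near_carrier(2) by auto

text \<open>In rank 2 the order complex is a graph. A maximal connected proper subposet misses exactly one
  element, which is linked to two others.\<close>

lemma rank_two:
  assumes S: "S \<subseteq> {..<m}" and ij: "S = {i, j}" "i \<noteq> j" and g: "g \<in> carrier G"
  shows "acyclic_below 1 (cosets_below S g) \<and> has_cycle 1 (cosets_below S g)"
proof -
  let ?P = "cosets_below S g"
  have finP: "finite ?P" by (rule finite_cosets_below [OF S])
  have gg: "near S g g" by (rule near_refl [OF S g])
  have less: "coset {} x < coset U x" if "U \<subset> S" "U \<noteq> {}" "near S x g" for U x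
    using coset_less_iff [of "{}" U x x] near_refl [of U x] near_carrier(1) [OF that(3)] that S by auto
  have mem: "coset U x \<in> ?P" if "U \<subset> S" "near S x g" for U x
    using that unfolding cosets_below_def by blast
  define F where "F = {R. R \<subset> ?P \<and> R \<noteq> {} \<and> acyclic_below 1 R}"
  have "finite F"
    by (rule finite_subset [of _ "Pow ?P"]) (use finP in \<open>auto simp: F_def\<close>)
  moreover have "{coset {} g} \<in> F"
  proof -
    have iS: "{i} \<subset> S" "{} \<subset> S" using ij by auto
    have "coset {i} g \<noteq> coset {} g" using less [OF iS(1) _ gg] by auto
    moreover have "coset {i} g \<in> ?P" "coset {} g \<in> ?P" using mem gg iS by blast+
    moreover have "acyclic_below 1 {coset {} g}" by (rule acyclic_below_apex) auto
    ultimately show ?thesis unfolding F_def by auto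
  qed
  ultimately obtain R where RF: "R \<in> F" and Rmax: "\<forall>R'\<in>F. R \<subseteq> R' \<longrightarrow> R = R'"
    using finite_has_maximal [of F] by blast
  then have R: "R \<subset> ?P" "R \<noteq> {}" "acyclic_below 1 R" by (auto simp: F_def)
  \<comment> \<open>Otherwise \<open>R\<close> is closed under comparability. Then the set
    \<open>T\<close> of points whose \<open>H\<close>-coset lies in \<open>R\<close> is stable under
    \<open>e {i}\<close> and \<open>e {j}\<close>, and \<open>near_induct\<close> makes
    \<open>R\<close> all of \<open>?P\<close>.\<close>
  have "\<exists>q\<in>?P - R. link R q \<noteq> {}"
  proof (rule ccontr)
    assume "\<not> ?thesis"
    then have closed: "q \<in> R" if "r \<in> R" "q \<in> ?P" "r < q \<or> q < r" for q r
      using that unfolding link_def by blast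
    define T where "T = {x. near S x g \<and> coset {} x \<in> R}"
    have down: "x \<in> T" if "coset U x \<in> R" "U \<subset> S" "near S x g" for U x
    proof (cases "U = {}")
      case True
      then show ?thesis using that by (simp add: T_def)
    next
      case False
      have "coset {} x \<in> ?P" using mem that ij by blast
      then show ?thesis
        using closed [OF that(1)] less [OF that(2) False that(3)] that(3) by (auto simp: T_def)
    qed
    have up: "coset U x \<in> R" if "x \<in> T" "U \<subset> S" for U x
    proof (cases "U = {}")
      case True
      then show ?thesis using that by (simp add: T_def)
    next
      case False
      have x: "near S x g" "coset {} x \<in> R" using that by (auto simp: T_def)
      show ?thesis
        using closed [OF x(2) mem [OF that(2) x(1)]] less [OF that(2) False x(1)] by simp
    qed
    obtain r where r: "r \<in> R" using R by auto
    then have "r \<in> ?P" using R by auto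
    then obtain U x where U: "r = coset U x" "U \<subset> S" "near S x g"
      unfolding cosets_below_def by (elim CollectE exE conjE)
    then have x: "x \<in> T" using down r by simp
    have "p \<in> R" if p: "p \<in> ?P" for p
    proof -
      obtain V y where V: "p = coset V y" "V \<subset> S" "near S y g"
        using p by (auto simp: cosets_below_def)
      have "near S x g" using x by (simp add: T_def)
      then have yx: "near S y x" by (rule near_trans [OF S V(3) near_sym [OF S]])
      have "y \<in> T"
      proof (rule near_induct [OF S _ yx x])
        show "S \<noteq> {}" using ij by auto
        show "T \<subseteq> carrier G" using near_carrier(1) by (auto simp: T_def)
        fix k a b assume k: "k \<in> S" and a: "a \<in> T" and ba: "near {k} b a"
        have kS: "{k} \<subset> S" "{k} \<subseteq> {..<m}" using ij k S by auto
        have "coset {k} b = coset {k} a"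
          using coset_eq_iff [OF kS(2) kS(2) near_carrier [OF ba]] ba by simp
        then have "coset {k} b \<in> R" using up [OF a kS(1)] by simp
        moreover have "near S b a" by (rule near_mono [OF _ S ba]) (use k in simp)
        then have "near S b g" by (rule near_trans [OF S]) (use a in \<open>simp add: T_def\<close>)
        ultimately show "b \<in> T" using down [OF _ kS(1)] by blast
      qed
      then show ?thesis using up V by blast
    qed
    then show False using R by auto
  qed
  then obtain q where q: "q \<in> ?P" "q \<notin> R" "link R q \<noteq> {}" by auto
  have "finite (link R q)"
    using link_subset R(1) finP by (meson finite_subset psubset_imp_subset)
  then have "acyclic_below (1 - 1) (link R q)"
    using acyclic_below_0 q(3) by simp
  then have ac: "acyclic_below 1 (insert q R)"
    by (rule acyclic_below_insert [OF R(3) q(2)])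
  have P: "insert q R = ?P"
  proof (rule ccontr)
    assume "insert q R \<noteq> ?P"
    then have "insert q R \<in> F" using R q ac by (auto simp: F_def)
    then show False using Rmax q(2) by blast
  qed
  have in_link: "p \<in> link R q" if "p \<in> ?P" "p < q \<or> q < p" for p
    using that P unfolding link_def by auto
  obtain U x where U: "q = coset U x" "U \<subset> S" "near S x g"
    using q(1) by (auto simp: cosets_below_def)
  \<comment> \<open>The two neighbours of a coset of \<open>H\<close> are the cosets of the two
    atoms through \<open>x\<close>; those of a coset of an atom are two cosets of \<open>H\<close>
    inside it.\<close>
  have "\<exists>u\<in>link R q. \<exists>v\<in>link R q. u \<noteq> v"
  proof (cases "U = {}")
    case True
    have "{i} \<subset> S" "{j} \<subset> S" using ij by auto
    then have "coset {i} x \<in> link R q" "coset {j} x \<in> link R q"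
      using in_link mem less U(1,3) True by auto
    moreover have "coset {i} x \<noteq> coset {j} x"
      using coset_eq_iff [of "{i}" "{j}" x x] near_carrier(1) [OF U(3)] ij S by auto
    ultimately show ?thesis by blast
  next
    case False
    have Um: "U \<subseteq> {..<m}" using U S by auto
    obtain y where y: "near U y x" "\<not> near {} y x"
      using ex_near_not_near [OF Um _ near_carrier(1) [OF U(3)], of "{}"] False by auto
    have yg: "near S y g"
      using near_trans [OF S near_mono [OF _ S y(1)] U(3)] U(2) by auto
    have "coset U y = q"
      using coset_eq_iff [OF Um Um near_carrier [OF y(1)]] y U(1) by simp
    then have "coset {} x < q" "coset {} y < q"
      using less [OF U(2) False U(3)] less [OF U(2) False yg] U(1) by auto
    moreover have "coset {} x \<in> ?P" "coset {} y \<in> ?P"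
      using mem U(3) yg ij by auto
    ultimately have "coset {} x \<in> link R q" "coset {} y \<in> link R q"
      using in_link by auto
    moreover have "coset {} y \<noteq> coset {} x"
      using coset_eq_iff [of "{}" "{}" y x] near_carrier [OF y(1)] y(2) by simp
    ultimately show ?thesis by blast
  qed
  then have "has_cycle (1 - 1) (link R q)"
    using has_cycle_0 by auto
  then have "has_cycle 1 (insert q R)"
    by (rule has_cycle_insert [OF R(3) q(2)])
  then show ?thesis using ac P by simp
qed

text \<open>All \<open>S\<close> and \<open>g\<close> are treated at once: the induction descends
  from \<open>S\<close> to \<open>S - {i}\<close>, and every open interval above the empty set has
  this form. Without a splitting the rank is at most 2.\<close>

lemma cosets_below_homology:
  assumes S: "S \<subseteq> {..<m}" and index: "card (carrier G) < 32 * card H" and g: "g \<in> carrier G"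
  shows "acyclic_below (int (card S) - 1) (cosets_below S g) \<and>
    has_cycle (int (card S) - 1) (cosets_below S g)"
  using S g
proof (induction "card S" arbitrary: S g rule: less_induct)
  case less
  note S = less.prems(1) and g = less.prems(2)
  have finS: "finite S" using S by (rule finite_subset) simp
  show ?case
  proof (cases "\<exists>i. splits S i")
    case True
    then obtain i where i: "splits S i" by auto
    then have iS: "i \<in> S" by (simp add: splits_def)
    then have card: "card S = Suc (card (S - {i}))"
      using finS by (metis card.remove)
    show ?thesis
    proof (rule splitting_step [OF S i g])
      fix x assume "x \<in> carrier G"
      then show "acyclic_below (int (card S) - 1 - 1) (cosets_below (S - {i}) x) \<and>
          has_cycle (int (card S) - 1 - 1) (cosets_below (S - {i}) x)"
        using less.hyps [of "S - {i}" x] card S by auto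
    qed
  next
    case False
    \<comment> \<open>The index bound passes from \<open>carrier G\<close> to \<open>e S\<close>, as
      both are measured against the same \<open>H\<close>.\<close>
    have "card (e S) \<le> card (carrier G)"
      by (rule card_mono [OF fin e_carrier [OF S]])
    then have "\<not> 3 \<le> card S" using ex_splits [OF S] index False by auto
    then consider "card S = 0" | "card S = 1" | "card S = 2" by linarith
    then show ?thesis
    proof cases
      case 1
      \<comment> \<open>The poset is empty and the degree is -1.\<close>
      then show ?thesis by (simp add: acyclic_below_minus_one has_cycle_minus_one)
    next
      case 2
      then obtain i where "S = {i}" by (auto simp: card_1_singleton_iff)
      then show ?thesis using False splits_singleton S by auto
    next
      case 3
      then obtain i j where "S = {i, j}" "i \<noteq> j" by (auto simp: card_2_iff)
      then show ?thesis using rank_two [OF S _ _ g] 3 by auto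
    qed
  qed
qed

section \<open>The coset poset and its rank function in terms of index sets\<close>

lemma coset_poset_eq: "coset_poset G H = cosets_below {..<m} \<one>"
proof (intro equalityI subsetI)
  fix r assume "r \<in> coset_poset G H"
  then obtain K x where r: "r = K #> x" "K \<in> group_interval G H" "K \<noteq> carrier G" "x \<in> carrier G"
    by (auto simp: coset_poset_def)
  then obtain S where S: "S \<subseteq> {..<m}" "K = e S"
    using e_surj [of K] by (auto simp: group_interval_def)
  then have "S \<subset> {..<m}" using r(3) e_full by auto
  then show "r \<in> cosets_below {..<m} \<one>"
    using r S unfolding cosets_below_def coset_def near_full by auto
next
  fix r assume "r \<in> cosets_below {..<m} \<one>"
  then obtain S x where r: "r = e S #> x" "S \<subset> {..<m}" "x \<in> carrier G"
    by (auto simp: cosets_below_def coset_def near_full)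
  moreover have "e S \<in> group_interval G H"
    using e_subgroup [of S] e_ge [of S] r(2) by (auto simp: group_interval_def)
  moreover have "e S \<noteq> carrier G"
    using e_le_iff [of "{..<m}" S] e_full r(2) by auto
  ultimately show "r \<in> coset_poset G H" unfolding coset_poset_def by blast
qed

lemma coset_full: "x \<in> carrier G \<Longrightarrow> coset {..<m} x = carrier G"
  using mem_coset_iff [of "{..<m}" x] by (auto simp: near_full)

lemma coset_poset_hat_eq:
  "coset_poset_hat G H = insert {} {coset S x | S x. S \<subseteq> {..<m} \<and> x \<in> carrier G}"
proof -
  have "{coset S x | S x. S \<subseteq> {..<m} \<and> x \<in> carrier G}
      = insert (carrier G) (cosets_below {..<m} \<one>)"
  proof (intro equalityI subsetI)
    fix r assume "r \<in> {coset S x | S x. S \<subseteq> {..<m} \<and> x \<in> carrier G}"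
    then obtain S x where r: "r = coset S x" "S \<subseteq> {..<m}" "x \<in> carrier G" by auto
    show "r \<in> insert (carrier G) (cosets_below {..<m} \<one>)"
    proof (cases "S = {..<m}")
      case True
      then show ?thesis using r coset_full by simp
    next
      case False
      then have "S \<subset> {..<m}" using r by auto
      then show ?thesis using r unfolding cosets_below_def near_full by auto
    qed
  next
    fix r assume "r \<in> insert (carrier G) (cosets_below {..<m} \<one>)"
    then consider "r = coset {..<m} \<one>" | S x where "r = coset S x" "S \<subset> {..<m}" "x \<in> carrier G"
      using coset_full [of \<one>] by (auto simp: cosets_below_def near_full)
    then show "r \<in> {coset S x | S x. S \<subseteq> {..<m} \<and> x \<in> carrier G}"
      by cases auto
  qed
  then show ?thesis
    by (auto simp: coset_poset_hat_def coset_poset_eq)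
qed

text \<open>The shift by one leaves rank 0 to the empty set, so that cosets of \<open>H\<close> have
  rank 1. The index set chosen is unique by \<open>coset_eq_iff\<close>.\<close>

definition coset_rank :: "'a set \<Rightarrow> nat" where
  "coset_rank r = (if r = {} then 0
     else Suc (card (SOME S. S \<subseteq> {..<m} \<and> (\<exists>x\<in>carrier G. r = coset S x))))"

lemma coset_not_empty: "S \<subseteq> {..<m} \<Longrightarrow> x \<in> carrier G \<Longrightarrow> coset S x \<noteq> {}"
  using mem_coset_iff near_refl by blast

lemma coset_rank_empty: "coset_rank {} = 0"
  by (simp add: coset_rank_def)

lemma coset_rank_coset:
  assumes S: "S \<subseteq> {..<m}" and x: "x \<in> carrier G"
  shows "coset_rank (coset S x) = Suc (card S)"
proof -
  have "(SOME T. T \<subseteq> {..<m} \<and> (\<exists>y\<in>carrier G. coset S x = coset T y)) = S"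
    by (rule some_equality) (use S x coset_eq_iff in blast)+
  then show ?thesis using coset_not_empty [OF S x] by (simp add: coset_rank_def)
qed

lemma coset_poset_hat_below:
  assumes S: "S \<subseteq> {..<m}" and g: "g \<in> carrier G"
  shows "coset_poset_hat G H \<inter> {{}<..<coset S g} = cosets_below S g"
proof (intro equalityI subsetI)
  fix r assume r: "r \<in> coset_poset_hat G H \<inter> {{}<..<coset S g}"
  then obtain T x where T: "r = coset T x" "T \<subseteq> {..<m}" "x \<in> carrier G"
    unfolding coset_poset_hat_eq by auto
  then have "T \<subset> S" "near S x g"
    using r coset_less_iff [OF T(2) S T(3) g] by auto
  then show "r \<in> cosets_below S g" using T unfolding cosets_below_def by blast
next
  fix r assume "r \<in> cosets_below S g"
  then obtain T x where T: "r = coset T x" "T \<subset> S" "near S x g"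
    by (auto simp: cosets_below_def)
  have T': "T \<subseteq> {..<m}" "x \<in> carrier G" using T S near_carrier by auto
  have "r < coset S g" using coset_less_iff [OF T'(1) S T'(2) g] T by simp
  moreover have "{} < r" using coset_not_empty [OF T'] T(1) by auto
  moreover have "r \<in> coset_poset_hat G H" using T(1) T' unfolding coset_poset_hat_eq by blast
  ultimately show "r \<in> coset_poset_hat G H \<inter> {{}<..<coset S g}" by simp
qed

lemma coset_poset_hat_between:
  assumes S: "S \<subseteq> {..<m}" and T: "T \<subset> S" and g: "g \<in> carrier G"
  shows "coset_poset_hat G H \<inter> {coset T g<..<coset S g} = coset_interval T S g"
proof (intro equalityI subsetI)
  have Tm: "T \<subseteq> {..<m}" using S T by auto
  fix r assume r: "r \<in> coset_poset_hat G H \<inter> {coset T g<..<coset S g}"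
  then obtain U x where U: "r = coset U x" "U \<subseteq> {..<m}" "x \<in> carrier G"
    unfolding coset_poset_hat_eq by auto
  have *: "coset T g < coset U x" "coset U x < coset S g" using r U(1) by auto
  then have "T \<subset> U" "near U g x" "U \<subset> S"
    using coset_less_iff [OF Tm U(2) g U(3)] coset_less_iff [OF U(2) S U(3) g] by auto
  moreover have "r = coset U g"
    using U coset_eq_iff [OF U(2,2) g U(3)] \<open>near U g x\<close> by simp
  ultimately show "r \<in> coset_interval T S g" unfolding coset_interval_def by blast
next
  have Tm: "T \<subseteq> {..<m}" using S T by auto
  fix r assume "r \<in> coset_interval T S g"
  then obtain U where U: "r = coset U g" "T \<subset> U" "U \<subset> S" unfolding coset_interval_def by blast
  have Um: "U \<subseteq> {..<m}" using U S by auto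
  have "coset T g < r" "r < coset S g"
    using coset_less_iff [OF Tm Um g g] coset_less_iff [OF Um S g g] U near_refl [OF Um g]
      near_refl [OF S g] by auto
  then show "r \<in> coset_poset_hat G H \<inter> {coset T g<..<coset S g}"
    using U(1) Um g unfolding coset_poset_hat_eq by auto
qed

text \<open>A representative of the smaller coset also represents the larger one. So every open
  interval is a \<open>cosets_below\<close> or a \<open>coset_interval\<close>.\<close>

lemma coset_poset_hat_less_E:
  assumes "p \<in> coset_poset_hat G H" "q \<in> coset_poset_hat G H" "p < q"
  obtains S g where "S \<subseteq> {..<m}" "g \<in> carrier G" "p = {}" "q = coset S g"
  | T S g where "S \<subseteq> {..<m}" "T \<subset> S" "g \<in> carrier G" "p = coset T g" "q = coset S g"
proof -
  obtain S y where S: "S \<subseteq> {..<m}" "y \<in> carrier G" "q = coset S y"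
    using assms(2,3) unfolding coset_poset_hat_eq by auto
  show thesis
  proof (cases "p = {}")
    case True
    then show ?thesis using that(1) S by blast
  next
    case False
    then obtain T g where T: "T \<subseteq> {..<m}" "g \<in> carrier G" "p = coset T g"
      using assms(1) unfolding coset_poset_hat_eq by auto
    then have "T \<subset> S" "near S g y"
      using assms(3) coset_less_iff [OF T(1) S(1) T(2) S(2)] S(3) by auto
    moreover have "q = coset S g"
      using S coset_eq_iff [OF S(1,1) T(2) S(2)] \<open>near S g y\<close> by simp
    ultimately show ?thesis using that(2) S(1) T by blast
  qed
qed

lemma coset_rank_less:
  assumes "p \<in> coset_poset_hat G H" "q \<in> coset_poset_hat G H" "p < q"
  shows "coset_rank p < coset_rank q"
  using assms
proof (cases rule: coset_poset_hat_less_E)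
  case (1 S g)
  then show ?thesis by (simp add: coset_rank_coset coset_rank_empty)
next
  case (2 T S g)
  have "finite S" using 2(1) by (rule finite_subset) simp
  then have "card T < card S" using 2(2) by (rule psubset_card_mono)
  moreover have "T \<subseteq> {..<m}" using 2 by auto
  ultimately show ?thesis using 2 by (simp add: coset_rank_coset)
qed

lemma coset_poset_hat_dense:
  assumes "p \<in> coset_poset_hat G H" "q \<in> coset_poset_hat G H" "p < q"
    and rank: "Suc (coset_rank p) < coset_rank q"
  shows "\<exists>r\<in>coset_poset_hat G H. p < r \<and> r < q"
  using assms(1-3)
proof (cases rule: coset_poset_hat_less_E)
  case (1 S g)
  then have "S \<noteq> {}" using rank by (auto simp: coset_rank_coset coset_rank_empty)
  then have "coset {} g \<in> cosets_below S g"
    using near_refl [OF 1(1,2)] unfolding cosets_below_def by blast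
  then have "coset {} g \<in> coset_poset_hat G H \<inter> {p<..<q}"
    using coset_poset_hat_below [OF 1(1,2)] 1(3,4) by simp
  then show ?thesis by auto
next
  case (2 T S g)
  have T: "T \<subseteq> {..<m}" using 2 by auto
  have finS: "finite S" using 2(1) by (rule finite_subset) simp
  obtain i where i: "i \<in> S" "i \<notin> T" using 2(2) by auto
  have finT: "finite T" using T by (rule finite_subset) simp
  have "Suc (card T) < card S" using rank 2 T by (simp add: coset_rank_coset)
  then have "insert i T \<noteq> S" using i finT by auto
  then have "coset (insert i T) g \<in> coset_interval T S g"
    using i 2(2) unfolding coset_interval_def by blast
  then have "coset (insert i T) g \<in> coset_poset_hat G H \<inter> {p<..<q}"
    using coset_poset_hat_between [OF 2(1-3)] 2(4,5) by simp
  then show ?thesis by auto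
qed

text \<open>Open intervals above the empty set are covered by \<open>cosets_below_homology\<close>;
  those between two cosets are proper parts of Boolean lattices, whatever the index.\<close>

theorem cohen_macaulay_coset_poset_hat:
  assumes index: "card (carrier G) < 32 * card H"
  shows "cohen_macaulay (coset_poset_hat G H)"
proof (rule cohen_macaulayI [where \<rho> = coset_rank and b = "{}" and t = "carrier G"])
  show "finite (coset_poset_hat G H)"
    unfolding coset_poset_hat_eq using finite_cosets by simp
  show "{} \<in> coset_poset_hat G H" "carrier G \<in> coset_poset_hat G H"
    by (simp_all add: coset_poset_hat_def)
  fix p assume "p \<in> coset_poset_hat G H"
  then consider "p = {}" | S x where "p = coset S x" "S \<subseteq> {..<m}" "x \<in> carrier G"
    unfolding coset_poset_hat_eq by auto
  then show "p \<le> carrier G"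
  proof cases
    case (2 S x)
    then show ?thesis unfolding coset_def using e_carrier r_coset_subset_G by auto
  qed simp
next
  fix p q assume p: "p \<in> coset_poset_hat G H" and q: "q \<in> coset_poset_hat G H" and pq: "p < q"
  show "acyclic_below (int (coset_rank q) - int (coset_rank p) - 2)
      (coset_poset_hat G H \<inter> {p<..<q})"
    using p q pq
  proof (cases rule: coset_poset_hat_less_E)
    case (1 S g)
    \<comment> \<open>The ranks are \<open>card S + 1\<close> and 0, so the required bound is
      \<open>card S - 1\<close>.\<close>
    then show ?thesis
      using cosets_below_homology [OF 1(1) index 1(2)]
      by (simp add: coset_poset_hat_below coset_rank_coset coset_rank_empty)
  next
    case (2 T S g)
    moreover have "T \<subseteq> {..<m}" using 2 by auto
    ultimately show ?thesis
      using acyclic_below_coset_interval [OF 2(1-3)]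
      by (simp add: coset_poset_hat_between coset_rank_coset)
  qed
qed (auto intro: coset_rank_less coset_poset_hat_dense)

theorem reduced_betti_coset_poset:
  assumes index: "card (carrier G) < 32 * card H"
  shows "reduced_betti (order_complex (coset_poset G H)) (int m - 1) \<noteq> 0"
proof (rule reduced_betti_top_neq_0)
  show "finite (coset_poset G H)"
    unfolding coset_poset_eq by (rule finite_cosets_below) simp
  show "has_cycle (int m - 1) (coset_poset G H)"
    using cosets_below_homology [of "{..<m}" \<one>] index by (simp add: coset_poset_eq)
  fix C assume C: "C \<in> order_complex (coset_poset G H)"
  then have chain: "pred_on.chain (coset_poset G H) (<) C" by (simp add: order_complex_def)
  \<comment> \<open>The empty set and \<open>carrier G\<close> are excluded, which leaves
    \<open>m\<close> possible ranks and hence at most \<open>m\<close> elements in a chain.\<close>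
  have rank: "coset_rank p \<in> {1..m}" if p: "p \<in> coset_poset G H" for p
  proof -
    obtain T x where T: "p = coset T x" "T \<subset> {..<m}" "x \<in> carrier G"
      using p by (auto simp: coset_poset_eq cosets_below_def near_full)
    have "card T < m" using psubset_card_mono [OF _ T(2)] by simp
    then show ?thesis using T by (simp add: coset_rank_coset)
  qed
  have "inj_on coset_rank C"
    by (rule chain_rank_inj [OF chain])
      (auto intro!: coset_rank_less simp: coset_poset_hat_def)
  moreover have "coset_rank ` C \<subseteq> {1..m}"
    using chain rank unfolding pred_on.chain_def by blast
  ultimately have "card C \<le> card {1..m}"
    by (metis card_image card_mono finite_atLeastAtMost)
  then show "int (card C) \<le> int m - 1 + 1" by simp
qed

end

text \<open>The given isomorphism goes from subgroups to sets, so its inverse serves as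
  \<open>e\<close>.\<close>

lemma boolean_interval_exists:
  assumes "group G" "finite (carrier G)" "subgroup H G" "boolean_of_rank (group_interval G H) m"
  obtains e where "boolean_interval G H m e"
proof -
  obtain f where f: "bij_betw f (group_interval G H) (Pow {..<m})"
    and le: "\<forall>x\<in>group_interval G H. \<forall>y\<in>group_interval G H. x \<le> y \<longleftrightarrow> f x \<le> f y"
    using assms(4) unfolding boolean_of_rank_def order_isomorphic_def by (elim exE conjE)
  let ?e = "inv_into (group_interval G H) f"
  have bij: "bij_betw ?e (Pow {..<m}) (group_interval G H)"
    by (rule bij_betw_inv_into [OF f])
  have "?e S \<subseteq> ?e T \<longleftrightarrow> S \<subseteq> T" if "S \<subseteq> {..<m}" "T \<subseteq> {..<m}" for S T
  proof -
    have "?e S \<in> group_interval G H" "?e T \<in> group_interval G H"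
      using bij_betwE [OF bij] that by simp_all
    moreover have "f (?e S) = S" "f (?e T) = T"
      using bij_betw_inv_into_right [OF f] that by simp_all
    ultimately show ?thesis using le by metis
  qed
  then have "boolean_interval G H m ?e"
    using assms bij by (simp add: boolean_interval_def boolean_interval_axioms_def)
  then show thesis by (rule that)
qed

text \<open>With rank \<open>m = n + 1\<close> the degree \<open>n\<close> is \<open>m - 1\<close>.
  For \<open>m = 0\<close> the coset poset is empty and the degree is -1.\<close>

theorem corollary4p20:
  fixes G :: "('a, 'b) monoid_scheme" and H :: "'a set" and m :: nat
  assumes "group G" and "finite (carrier G)" and "subgroup H G"
    and "boolean_of_rank (group_interval G H) m"
    and "card (rcosets\<^bsub>G\<^esub> H) < 32"
  shows "cohen_macaulay (coset_poset_hat G H) \<and>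
    reduced_betti (order_complex (coset_poset G H)) (int m - 1) \<noteq> 0"
proof -
  obtain e where "boolean_interval G H m e"
    using boolean_interval_exists [OF assms(1-4)] .
  then interpret boolean_interval G H m e .
  \<comment> \<open>Lagrange's theorem turns the bound on the index into a bound on
    \<open>card (carrier G)\<close>.\<close>
  have "card (rcosets\<^bsub>G\<^esub> H) * card H = order G"
    by (rule lagrange [OF assms(3)])
  moreover have "card H > 0"
    by (rule subgroup.finite_imp_card_positive [OF assms(3,2)])
  ultimately have "card (carrier G) < 32 * card H"
    using assms(5) by (metis mult_less_mono1 order_def)
  then show ?thesis
    using cohen_macaulay_coset_poset_hat reduced_betti_coset_poset by blast
qed

end
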